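(* Let $\Omega$ be a class of $C^*$-algebras and let $A$ be a unital $C^*$-algebra in $\mathrm{GTA}\Omega$. Then for any $\epsilon > 0$, any $m \in \mathbb{Z}_{>0}$, any $x_1,\ldots,x_m \in A$, and any positive element $a \in A_+$ with $\|a\| = 1$, there exist $y_1, \ldots, y_m \in A$, a $C^*$-subalgebra $B \subset A$ with $B \in \Omega$, and an element $r \in B_+$ with $\|r\| \leq 1$, such that (1) $\|y_j - x_j\| < \epsilon$ for all $j = 1,\ldots,m$; (2) $ry_j \in B$ and $y_j r \in B$ for all $j = 1,\ldots,m$; (3) $\| r x_j - x_j r\| < \epsilon$ for all $j = 1, \ldots, m$; (4) $1_A - r \precsim_A a$; and (5) $\| rar\| \geq 1 - \epsilon$.
   Context: Notation. For a $C^*$-algebra $A$, $A_+$ denotes its set of positive elements. For $x \in A$, a subset $B \subset A$ and $\epsilon>0$, $x \in_{\epsilon} B$ means that there is $b \in B$ with $\|x-b\|<\epsilon$. For $a \in A_+$ and $\epsilon > 0$, $(a-\epsilon)_+$ is the element obtained by applying the function $t \mapsto \max\{t-\epsilon,0\}$ to $a$ by continuous functional calculus. For $a,b\in A_+$, $a \precsim_A b$ denotes Cuntz subequivalence in $A$: there is a sequence $(v_n)$ in $A$ with $\|v_n b v_n^* - a\| \to 0$. Definition of $\mathrm{GTA}\Omega$. Let $\Omega$ be a class of $C^*$-algebras. A simple $C^*$-algebra $A$ belongs to the class $\mathrm{GTA}\Omega$ if, for any $\epsilon > 0$, any finite subset $F \subset A$, any $a \in A_+$ with $\|a\| = 1$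 and any $b \in A_+$ with $\|b\| \leq 1$, there exist a $C^*$-subalgebra $B \subset A$ with $B \in \Omega$ and an element $r \in B_+$ with $\|r\| \leq 1$ such that (1') $rx \in_{\epsilon} B$ and $xr \in_{\epsilon} B$ for all $x \in F$; (2') $\| rx - xr\| < \epsilon$ for all $x \in F$; (3') $(b^2 - brb -\epsilon)_+ \precsim_A a$; and (4') $\| rar\| \geq 1 - \epsilon$. *)

theory Defs
  imports "HOL-Analysis.Analysis" "HOL-Computational_Algebra.Polynomial"
begin

section \<open>C*-algebras as types\<close>

text \<open>
  The ambient C*-algebra \<open>A\<close> is a type. A unit is not required; the real vector space structure
  inherited from \<^class>\<open>real_normed_algebra\<close> is the restriction of the complex one.
\<close>

class cstar_algebra = real_normed_algebra + banach +
  fixes scaleC :: "complex \<Rightarrow> 'a \<Rightarrow> 'a"  (infixr "*\<^sub>C" 75)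
    and star :: "'a \<Rightarrow> 'a"  ("(_\<^sup>\<star>)" [1000] 999)
  assumes scaleR_scaleC: "r *\<^sub>R x = complex_of_real r *\<^sub>C x"
    and scaleC_add_right: "c *\<^sub>C (x + y) = c *\<^sub>C x + c *\<^sub>C y"
    and scaleC_add_left: "(c + d) *\<^sub>C x = c *\<^sub>C x + d *\<^sub>C x"
    and scaleC_scaleC: "c *\<^sub>C d *\<^sub>C x = (c * d) *\<^sub>C x"
    and mult_scaleC_left: "(c *\<^sub>C x) * y = c *\<^sub>C (x * y)"
    and mult_scaleC_right: "x * (c *\<^sub>C y) = c *\<^sub>C (x * y)"
    and norm_scaleC: "norm (c *\<^sub>C x) = cmod c * norm x"
    and star_star: "(x\<^sup>\<star>)\<^sup>\<star> = x"
    and star_add: "(x + y)\<^sup>\<star> = x\<^sup>\<star> + y\<^sup>\<star>"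
    and star_scaleC: "(c *\<^sub>C x)\<^sup>\<star> = cnj c *\<^sub>C x\<^sup>\<star>"
    and star_mult: "(x * y)\<^sup>\<star> = y\<^sup>\<star> * x\<^sup>\<star>"
    and norm_star_mult_self: "norm (x\<^sup>\<star> * x) = (norm x)\<^sup>2"

text \<open>
  \<^class>\<open>real_normed_algebra_1\<close> asks for \<open>1 \<noteq> 0\<close> and \<open>norm 1 = 1\<close>; the latter is automatic in a
  nonzero unital C*-algebra.
\<close>

class unital_cstar_algebra = cstar_algebra + real_normed_algebra_1

definition cstar_subalgebra :: "'a::cstar_algebra set \<Rightarrow> bool" where
  "cstar_subalgebra B \<longleftrightarrow>
     0 \<in> B \<and> (\<forall>x\<in>B. \<forall>y\<in>B. x + y \<in> B) \<and> (\<forall>c. \<forall>x\<in>B. c *\<^sub>C x \<in> B) \<and>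
     (\<forall>x\<in>B. \<forall>y\<in>B. x * y \<in> B) \<and> (\<forall>x\<in>B. x\<^sup>\<star> \<in> B) \<and> closed B"

definition closed_ideal :: "'a::cstar_algebra set \<Rightarrow> bool" where
  "closed_ideal I \<longleftrightarrow>
     0 \<in> I \<and> (\<forall>x\<in>I. \<forall>y\<in>I. x + y \<in> I) \<and> (\<forall>c. \<forall>x\<in>I. c *\<^sub>C x \<in> I) \<and>
     (\<forall>x\<in>I. \<forall>z. z * x \<in> I \<and> x * z \<in> I) \<and> closed I"

definition simple_cstar_algebra :: "'a::cstar_algebra itself \<Rightarrow> bool" where
  "simple_cstar_algebra _ \<longleftrightarrow> (\<forall>I::'a set. closed_ideal I \<longrightarrow> I = {0} \<or> I = UNIV)"

section \<open>Classes of C*-algebras\<close>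

text \<open>
  A class \<open>\<Omega>\<close> of C*-algebras is a set of C*-algebras given as structures with an explicit carrier,
  so that both \<open>A\<close> and its C*-subalgebras can be members.
\<close>

record 'a cstar_structure =
  carr :: "'a set"
  zer :: 'a
  plu :: "'a \<Rightarrow> 'a \<Rightarrow> 'a"
  scl :: "complex \<Rightarrow> 'a \<Rightarrow> 'a"
  mul :: "'a \<Rightarrow> 'a \<Rightarrow> 'a"
  adj :: "'a \<Rightarrow> 'a"
  nrm :: "'a \<Rightarrow> real"

locale is_cstar_algebra =
  fixes X :: "'a cstar_structure"
  assumes zer_closed: "zer X \<in> carr X"
    and plu_closed: "\<lbrakk>x \<in> carr X; y \<in> carr X\<rbrakk> \<Longrightarrow> plu X x y \<in> carr X"
    and scl_closed: "x \<in> carr X \<Longrightarrow> scl X c x \<in> carr X"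
    and mul_closed: "\<lbrakk>x \<in> carr X; y \<in> carr X\<rbrakk> \<Longrightarrow> mul X x y \<in> carr X"
    and adj_closed: "x \<in> carr X \<Longrightarrow> adj X x \<in> carr X"
    and plu_assoc: "\<lbrakk>x \<in> carr X; y \<in> carr X; z \<in> carr X\<rbrakk> \<Longrightarrow> plu X (plu X x y) z = plu X x (plu X y z)"
    and plu_commute: "\<lbrakk>x \<in> carr X; y \<in> carr X\<rbrakk> \<Longrightarrow> plu X x y = plu X y x"
    and plu_zer: "x \<in> carr X \<Longrightarrow> plu X x (zer X) = x"
    and plu_inverse: "x \<in> carr X \<Longrightarrow> plu X x (scl X (-1) x) = zer X"
    and scl_plu: "\<lbrakk>x \<in> carr X; y \<in> carr X\<rbrakk> \<Longrightarrow> scl X c (plu X x y) = plu X (scl X c x) (scl X c y)"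
    and scl_add: "x \<in> carr X \<Longrightarrow> scl X (c + d) x = plu X (scl X c x) (scl X d x)"
    and scl_scl: "x \<in> carr X \<Longrightarrow> scl X c (scl X d x) = scl X (c * d) x"
    and scl_one: "x \<in> carr X \<Longrightarrow> scl X 1 x = x"
    and mul_assoc: "\<lbrakk>x \<in> carr X; y \<in> carr X; z \<in> carr X\<rbrakk> \<Longrightarrow> mul X (mul X x y) z = mul X x (mul X y z)"
    and mul_plu_left: "\<lbrakk>x \<in> carr X; y \<in> carr X; z \<in> carr X\<rbrakk> \<Longrightarrow> mul X (plu X x y) z = plu X (mul X x z) (mul X y z)"
    and mul_plu_right: "\<lbrakk>x \<in> carr X; y \<in> carr X; z \<in> carr X\<rbrakk> \<Longrightarrow> mul X x (plu X y z) = plu X (mul X x y) (mul X x z)"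
    and mul_scl_left: "\<lbrakk>x \<in> carr X; y \<in> carr X\<rbrakk> \<Longrightarrow> mul X (scl X c x) y = scl X c (mul X x y)"
    and mul_scl_right: "\<lbrakk>x \<in> carr X; y \<in> carr X\<rbrakk> \<Longrightarrow> mul X x (scl X c y) = scl X c (mul X x y)"
    and nrm_eq_0: "x \<in> carr X \<Longrightarrow> nrm X x = 0 \<longleftrightarrow> x = zer X"
    and nrm_plu: "\<lbrakk>x \<in> carr X; y \<in> carr X\<rbrakk> \<Longrightarrow> nrm X (plu X x y) \<le> nrm X x + nrm X y"
    and nrm_scl: "x \<in> carr X \<Longrightarrow> nrm X (scl X c x) = cmod c * nrm X x"
    and nrm_mul: "\<lbrakk>x \<in> carr X; y \<in> carr X\<rbrakk> \<Longrightarrow> nrm X (mul X x y) \<le> nrm X x * nrm X y"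
    and adj_adj: "x \<in> carr X \<Longrightarrow> adj X (adj X x) = x"
    and adj_plu: "\<lbrakk>x \<in> carr X; y \<in> carr X\<rbrakk> \<Longrightarrow> adj X (plu X x y) = plu X (adj X x) (adj X y)"
    and adj_scl: "x \<in> carr X \<Longrightarrow> adj X (scl X c x) = scl X (cnj c) (adj X x)"
    and adj_mul: "\<lbrakk>x \<in> carr X; y \<in> carr X\<rbrakk> \<Longrightarrow> adj X (mul X x y) = mul X (adj X y) (adj X x)"
    and nrm_cstar: "x \<in> carr X \<Longrightarrow> nrm X (mul X (adj X x) x) = (nrm X x)\<^sup>2"
    and complete:
      "\<lbrakk>\<And>n. s n \<in> carr X;
        \<And>e. e > 0 \<Longrightarrow> \<exists>N. \<forall>m\<ge>N. \<forall>n\<ge>N. nrm X (plu X (s m) (scl X (-1) (s n))) < e\<rbrakk>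
       \<Longrightarrow> \<exists>l\<in>carr X. (\<lambda>n. nrm X (plu X (s n) (scl X (-1) l))) \<longlonglongrightarrow> 0"

definition induced_structure :: "'a::cstar_algebra set \<Rightarrow> 'a cstar_structure" where
  "induced_structure B =
     \<lparr>carr = B, zer = 0, plu = (+), scl = (*\<^sub>C), mul = (*), adj = star, nrm = norm\<rparr>"

lemma scaleC_minus_one: "(- 1) *\<^sub>C x = - (x::'a::cstar_algebra)"
  using scaleR_scaleC[of "-1" x] by simp

lemma scaleC_one: "1 *\<^sub>C x = (x::'a::cstar_algebra)"
  using scaleR_scaleC[of 1 x] by simp

lemma is_cstar_algebra_induced_structure:
  assumes "cstar_subalgebra (B :: 'a::cstar_algebra set)"
  shows "is_cstar_algebra (induced_structure B)"
proof
  fix s :: "nat \<Rightarrow> 'a"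
  assume s: "\<And>n. s n \<in> carr (induced_structure B)"
    and c: "\<And>e. e > 0 \<Longrightarrow> \<exists>N. \<forall>m\<ge>N. \<forall>n\<ge>N. nrm (induced_structure B)
             (plu (induced_structure B) (s m) (scl (induced_structure B) (-1) (s n))) < e"
  have "Cauchy s"
    unfolding Cauchy_def using c
    by (simp add: induced_structure_def scaleC_minus_one dist_norm)
  then obtain l where l: "s \<longlonglongrightarrow> l"
    using Cauchy_convergent convergent_def by blast
  have "l \<in> B"
    using assms s l unfolding cstar_subalgebra_def induced_structure_def
    by (metis (no_types, lifting) closed_sequentially cstar_structure.select_convs(1))
  moreover have "(\<lambda>n. norm (s n - l)) \<longlonglongrightarrow> 0"
    using l by (simp add: LIM_zero tendsto_norm_zero)
  ultimately show "\<exists>l\<in>carr (induced_structure B).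
      (\<lambda>n. nrm (induced_structure B) (plu (induced_structure B) (s n)
             (scl (induced_structure B) (-1) l))) \<longlonglongrightarrow> 0"
    by (auto simp: induced_structure_def scaleC_minus_one)
qed (use assms in \<open>auto simp: induced_structure_def cstar_subalgebra_def
      scaleC_one scaleC_minus_one scaleC_add_right scaleC_add_left scaleC_scaleC mult_scaleC_left
      mult_scaleC_right norm_scaleC star_star star_add star_scaleC star_mult
      norm_star_mult_self algebra_simps norm_triangle_ineq norm_mult_ineq\<close>)

section \<open>Spectrum, positivity and functional calculus\<close>

text \<open>
  The spectrum of \<open>a \<in> B\<close> in the unitization \<open>\<complex> \<oplus> B\<close>: the condition inside the negation says that
  \<open>(\<mu>, b)\<close> is a two-sided inverse of \<open>(\<lambda>, -a)\<close> for the product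
  \<open>(\<lambda>, x) (\<mu>, y) = (\<lambda> \<mu>, \<lambda> y + \<mu> x + x y)\<close>. It always contains \<open>0\<close>; if \<open>B\<close> has a unit, this is the
  spectrum in \<open>B\<close> together with \<open>0\<close>, which is immaterial for positivity and for functions
  vanishing at \<open>0\<close>.
\<close>

definition spectrum_in :: "'a::cstar_algebra set \<Rightarrow> 'a \<Rightarrow> complex set" where
  "spectrum_in B a =
     {z. \<not> (\<exists>\<mu>. \<exists>b\<in>B. z * \<mu> = 1 \<and>
              z *\<^sub>C b - \<mu> *\<^sub>C a - a * b = 0 \<and> z *\<^sub>C b - \<mu> *\<^sub>C a - b * a = 0)}"

definition positive_in :: "'a::cstar_algebra set \<Rightarrow> 'a set" where
  "positive_in B = {a \<in> B. a\<^sup>\<star> = a \<and> (\<forall>z\<in>spectrum_in B a. Im z = 0 \<and> 0 \<le> Re z)}"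

text \<open>
  The value at \<open>a\<close> of the polynomial \<open>t \<mapsto> t * poly p t\<close>, which makes sense without a unit because
  its constant term vanishes; \<open>((*) a ^^ i) a\<close> is the power of \<open>a\<close> with exponent \<open>i + 1\<close>.
\<close>

definition poly_no_const :: "real poly \<Rightarrow> 'a::cstar_algebra \<Rightarrow> 'a" where
  "poly_no_const p a = (\<Sum>i\<le>degree p. coeff p i *\<^sub>R ((*) a ^^ i) a)"

text \<open>
  Continuous functional calculus \<open>f(a)\<close> for self-adjoint \<open>a\<close> and real-valued continuous \<open>f\<close> with
  \<open>f 0 = 0\<close>: the limit of \<open>q\<^sub>n(a)\<close> for real polynomials \<open>q\<^sub>n\<close> without constant term that converge to
  \<open>f\<close> uniformly on the spectrum of \<open>a\<close>.
\<close>

definition cont_fun_calc :: "(real \<Rightarrow> real) \<Rightarrow> 'a::cstar_algebra \<Rightarrow> 'a" where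
  "cont_fun_calc f a =
     (THE y. \<exists>p :: nat \<Rightarrow> real poly.
        uniform_limit {t. complex_of_real t \<in> spectrum_in UNIV a}
          (\<lambda>n t. t * poly (p n) t) f sequentially \<and>
        (\<lambda>n. poly_no_const (p n) a) \<longlonglongrightarrow> y)"

definition cut_down :: "'a::cstar_algebra \<Rightarrow> real \<Rightarrow> 'a" where
  "cut_down a \<epsilon> = cont_fun_calc (\<lambda>t. max (t - \<epsilon>) 0) a"

section \<open>Cuntz subequivalence and the class GTA\<close>

definition cuntz_le :: "'a::cstar_algebra \<Rightarrow> 'a \<Rightarrow> bool"  (infix "\<precsim>" 50) where
  "a \<precsim> b \<longleftrightarrow> (\<exists>v :: nat \<Rightarrow> 'a. (\<lambda>n. norm (v n * b * (v n)\<^sup>\<star> - a)) \<longlonglongrightarrow> 0)"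

definition approx_in :: "real \<Rightarrow> 'a::real_normed_vector \<Rightarrow> 'a set \<Rightarrow> bool" where
  "approx_in \<epsilon> x B \<longleftrightarrow> (\<exists>b\<in>B. norm (x - b) < \<epsilon>)"

definition in_GTA :: "'a::cstar_algebra itself \<Rightarrow> 'a cstar_structure set \<Rightarrow> bool" where
  "in_GTA _ \<Omega> \<longleftrightarrow>
     simple_cstar_algebra TYPE('a) \<and>
     (\<forall>(\<epsilon>::real) (F::'a set) (a::'a) (b::'a).
        \<epsilon> > 0 \<longrightarrow> finite F \<longrightarrow> a \<in> positive_in UNIV \<longrightarrow> norm a = 1 \<longrightarrow>
        b \<in> positive_in UNIV \<longrightarrow> norm b \<le> 1 \<longrightarrow>
        (\<exists>B r. cstar_subalgebra B \<and> induced_structure B \<in> \<Omega> \<and>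
               r \<in> positive_in B \<and> norm r \<le> 1 \<and>
               (\<forall>x\<in>F. approx_in \<epsilon> (r * x) B \<and> approx_in \<epsilon> (x * r) B) \<and>
               (\<forall>x\<in>F. norm (r * x - x * r) < \<epsilon>) \<and>
               cut_down (b * b - b * r * b) \<epsilon> \<precsim> a \<and>
               norm (r * a * r) \<ge> 1 - \<epsilon>))"

end

theory Submission
  imports Defs "HOL-Computational_Algebra.Fundamental_Theorem_Algebra"
begin

text \<open>
  Apply the defining property of GTA with \<open>b = 1\<close> and a tolerance \<open>\<delta>\<close> much smaller than \<open>\<epsilon>\<close> to get
  \<open>r\<^sub>0\<close>, and let \<open>r = f(r\<^sub>0)\<close> for a piecewise linear \<open>f\<close> close to the identity that is \<open>0\<close> on \<open>[0, \<eta>]\<close>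
  and \<open>1\<close> on \<open>[1 - \<eta>, 1]\<close>. Then \<open>1 - r\<close> has the form \<open>c (1 - r\<^sub>0 - \<delta>)\<^sub>+ c\<^sup>*\<close>, which gives the Cuntz
  subequivalence without a cut-down. With \<open>h = g(r\<^sub>0)\<close>, where \<open>g 0 = 0\<close> and \<open>g = 1\<close> on the support of
  \<open>f\<close>, the part \<open>(1 - h) x (1 - h)\<close> of \<open>x\<close> is annihilated by \<open>r\<close>, and the rest of \<open>x\<close> is moved into \<open>B\<close>.

  The functional calculus rests on \<open>\<parallel>p(a)\<parallel> \<le> sup \<bar>p\<bar>\<close> over the spectrum of a self-adjoint \<open>a\<close>. By
  factoring polynomials this reduces to the fact that \<open>1 - b\<^sup>2\<close> is not invertible if \<open>b\<close> is self-adjoint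
  of norm \<open>1\<close>; otherwise some \<open>\<kappa> - b\<^sup>2\<close> with \<open>\<kappa> < 1\<close> would be the square of a self-adjoint \<open>g\<close>
  commuting with \<open>b\<close>, whence \<open>\<parallel>b\<parallel>\<^sup>2 \<le> \<parallel>b\<^sup>2 + g\<^sup>2\<parallel> = \<kappa>\<close>.
\<close>

section \<open>Scalars and the involution\<close>

lemma scaleC_zero_left [simp]: "0 *\<^sub>C x = (0::'a::cstar_algebra)"
  using scaleR_scaleC[of 0 x] by simp

lemma scaleC_zero_right [simp]: "c *\<^sub>C 0 = (0::'a::cstar_algebra)"
  using scaleC_add_right[of c 0 0] by simp

lemma scaleC_minus_right: "c *\<^sub>C (- x) = - (c *\<^sub>C x :: 'a::cstar_algebra)"
  using scaleC_add_right[of c x "-x"] by (simp add: add_eq_0_iff2)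

lemma scaleC_minus_left: "(- c) *\<^sub>C x = - (c *\<^sub>C x :: 'a::cstar_algebra)"
  using scaleC_add_left[of c "-c" x] by (simp add: add_eq_0_iff2)

lemma scaleC_diff_right: "c *\<^sub>C (x - y) = c *\<^sub>C x - (c *\<^sub>C y :: 'a::cstar_algebra)"
  using scaleC_add_right[of c x "-y"] by (simp add: scaleC_minus_right)

lemma scaleC_diff_left: "(c - d) *\<^sub>C x = c *\<^sub>C x - (d *\<^sub>C x :: 'a::cstar_algebra)"
  using scaleC_add_left[of c "-d" x] by (simp add: scaleC_minus_left)

lemma star_zero [simp]: "0\<^sup>\<star> = (0::'a::cstar_algebra)"
  using star_add[of "0::'a" 0] by simp

lemma star_minus: "(- x)\<^sup>\<star> = - (x\<^sup>\<star> :: 'a::cstar_algebra)"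
  using star_add[of x "-x"] by (simp add: add_eq_0_iff2)

lemma star_diff: "(x - y)\<^sup>\<star> = x\<^sup>\<star> - (y\<^sup>\<star> :: 'a::cstar_algebra)"
  using star_add[of x "-y"] by (simp add: star_minus)

lemma star_scaleR: "(t *\<^sub>R x)\<^sup>\<star> = t *\<^sub>R (x\<^sup>\<star> :: 'a::cstar_algebra)"
  by (simp add: scaleR_scaleC star_scaleC)

lemma star_one [simp]: "1\<^sup>\<star> = (1::'a::unital_cstar_algebra)"
  by (metis mult.right_neutral star_mult star_star)

lemma norm_star [simp]: "norm (x\<^sup>\<star>) = norm (x::'a::cstar_algebra)"
proof -
  have *: "norm y \<le> norm (y\<^sup>\<star>)" for y :: 'a
  proof (cases "y = 0")
    case False
    have "norm y * norm y \<le> norm (y\<^sup>\<star>) * norm y"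
      using norm_star_mult_self[of y] norm_mult_ineq[of "y\<^sup>\<star>" y] by (simp add: power2_eq_square)
    then show ?thesis using False by simp
  qed simp
  show ?thesis using *[of x] *[of "x\<^sup>\<star>"] by (simp add: star_star)
qed

lemma bounded_linear_star: "bounded_linear (star :: 'a \<Rightarrow> 'a::cstar_algebra)"
  by (rule bounded_linear_intro[where K=1]) (simp_all add: star_add star_scaleR)

lemma tendsto_star: "(f \<longlongrightarrow> l) F \<Longrightarrow> ((\<lambda>x. (f x)\<^sup>\<star>) \<longlongrightarrow> (l\<^sup>\<star> :: 'a::cstar_algebra)) F"
  by (rule bounded_linear.tendsto[OF bounded_linear_star])

lemma star_power: "(x ^ n)\<^sup>\<star> = (x\<^sup>\<star> :: 'a::unital_cstar_algebra) ^ n"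
  by (induction n) (simp_all add: star_mult power_commutes)

lemma norm_selfadjoint_square:
  "x\<^sup>\<star> = x \<Longrightarrow> norm (x * x) = (norm (x::'a::cstar_algebra))\<^sup>2"
  using norm_star_mult_self[of x] by simp

lemma scaleC_one_mult_left [simp]: "(c *\<^sub>C 1) * x = c *\<^sub>C (x::'a::unital_cstar_algebra)"
  by (simp add: mult_scaleC_left)

lemma scaleC_one_mult_right [simp]: "x * (c *\<^sub>C 1) = c *\<^sub>C (x::'a::unital_cstar_algebra)"
  by (simp add: mult_scaleC_right)

section \<open>Invertible elements and multipliers\<close>

text \<open>The inverse is an explicit argument because later steps need its norm, its
  self-adjointness or its membership in \<open>multipliers B\<close>.\<close>

definition inverse_pair :: "'a::monoid_mult \<Rightarrow> 'a \<Rightarrow> bool" where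
  "inverse_pair x y \<longleftrightarrow> x * y = 1 \<and> y * x = 1"

definition unit_elem :: "'a::monoid_mult \<Rightarrow> bool" where
  "unit_elem x \<longleftrightarrow> (\<exists>y. inverse_pair x y)"

lemma inverse_pair_mult:
  assumes "inverse_pair x x'" "inverse_pair y y'"
  shows "inverse_pair (x * y) (y' * x')"
proof -
  have "x * y * (y' * x') = x * (y * y') * x'" "y' * x' * (x * y) = y' * (x' * x) * y"
    by (simp_all only: mult.assoc)
  then show ?thesis using assms by (simp add: inverse_pair_def)
qed

lemma unit_elem_mult: "unit_elem x \<Longrightarrow> unit_elem y \<Longrightarrow> unit_elem (x * y)"
  unfolding unit_elem_def using inverse_pair_mult by blast

lemma inverse_pair_scaleC:
  fixes x y :: "'a::unital_cstar_algebra"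
  assumes "c \<noteq> 0" "inverse_pair x y"
  shows "inverse_pair (c *\<^sub>C x) (inverse c *\<^sub>C y)"
proof -
  have "(c *\<^sub>C x) * (inverse c *\<^sub>C y) = (inverse c * c) *\<^sub>C (x * y)"
    "(inverse c *\<^sub>C y) * (c *\<^sub>C x) = (c * inverse c) *\<^sub>C (y * x)"
    by (simp_all only: mult_scaleC_left mult_scaleC_right scaleC_scaleC)
  then show ?thesis using assms by (simp add: inverse_pair_def scaleC_one)
qed

lemma unit_elem_scaleC:
  "c \<noteq> 0 \<Longrightarrow> unit_elem (x::'a::unital_cstar_algebra) \<Longrightarrow> unit_elem (c *\<^sub>C x)"
  unfolding unit_elem_def using inverse_pair_scaleC by blast

lemma inverse_pair_commute:
  assumes "inverse_pair x y" "x * z = z * x"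
  shows "y * z = z * y"
proof -
  have "y * z = y * (z * x) * y" using assms(1) by (simp add: inverse_pair_def mult.assoc)
  also have "\<dots> = (y * x) * z * y" by (simp add: mult.assoc flip: assms(2))
  finally show ?thesis using assms(1) by (simp add: inverse_pair_def)
qed

lemma inverse_pair_selfadjoint:
  fixes x :: "'a::unital_cstar_algebra"
  assumes "inverse_pair x y" "x\<^sup>\<star> = x"
  shows "y\<^sup>\<star> = y"
proof -
  have "(x * y)\<^sup>\<star> = 1" using assms(1) by (simp add: inverse_pair_def)
  then have "y\<^sup>\<star> * x = 1" by (simp add: star_mult assms(2))
  moreover have "y\<^sup>\<star> = (y\<^sup>\<star> * x) * y" using assms(1) by (simp add: inverse_pair_def mult.assoc)
  ultimately show ?thesis by simp
qed

text \<open>The idealizer of \<open>B\<close>. The unit need not lie in \<open>B\<close>, so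
  inverses and functions not vanishing at 0 may leave \<open>B\<close>; those needed here stay in
  this set, and a product with an element of \<open>B\<close> returns to \<open>B\<close>.\<close>

definition multipliers :: "'a::cstar_algebra set \<Rightarrow> 'a set" where
  "multipliers B = {x. \<forall>b\<in>B. x * b \<in> B \<and> b * x \<in> B}"

lemma cstar_subalgebra_UNIV: "cstar_subalgebra UNIV"
  by (simp add: cstar_subalgebra_def)

lemma cstar_subalgebraD:
  assumes "cstar_subalgebra B"
  shows "0 \<in> B" "x \<in> B \<Longrightarrow> y \<in> B \<Longrightarrow> x + y \<in> B" "x \<in> B \<Longrightarrow> c *\<^sub>C x \<in> B"
    "x \<in> B \<Longrightarrow> y \<in> B \<Longrightarrow> x * y \<in> B" "x \<in> B \<Longrightarrow> x\<^sup>\<star> \<in> B" "closed B"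
  using assms by (simp_all add: cstar_subalgebra_def)

lemma cstar_subalgebra_diff:
  assumes "cstar_subalgebra B" "x \<in> B" "y \<in> B"
  shows "x - y \<in> B"
proof -
  have "x + (-1) *\<^sub>C y \<in> B" using assms by (simp add: cstar_subalgebra_def)
  then show ?thesis by (simp add: scaleC_minus_one)
qed

lemma multipliersD:
  "x \<in> multipliers B \<Longrightarrow> b \<in> B \<Longrightarrow> x * b \<in> B"
  "x \<in> multipliers B \<Longrightarrow> b \<in> B \<Longrightarrow> b * x \<in> B"
  by (auto simp: multipliers_def)

lemma subalgebra_multipliers: "cstar_subalgebra B \<Longrightarrow> x \<in> B \<Longrightarrow> x \<in> multipliers B"
  by (simp add: multipliers_def cstar_subalgebraD(4))

lemma multipliers_one: "1 \<in> multipliers (B::'a::unital_cstar_algebra set)"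
  by (auto simp: multipliers_def)

lemma multipliers_mult:
  assumes "x \<in> multipliers B" "y \<in> multipliers B"
  shows "x * y \<in> multipliers B"
proof -
  have "x * y * b \<in> B \<and> b * (x * y) \<in> B" if "b \<in> B" for b
    using assms that multipliersD[of x B] multipliersD[of y B] by (metis mult.assoc)
  then show ?thesis by (simp add: multipliers_def)
qed

lemma multipliers_power:
  "x \<in> multipliers (B::'a::unital_cstar_algebra set) \<Longrightarrow> x ^ n \<in> multipliers B"
  by (induction n) (auto simp: multipliers_one multipliers_mult)

context
  fixes B :: "'a::cstar_algebra set"
  assumes B: "cstar_subalgebra B"
begin

lemma multipliers_zero: "0 \<in> multipliers B"
  by (simp add: multipliers_def cstar_subalgebraD[OF B])

lemma multipliers_add: "x \<in> multipliers B \<Longrightarrow> y \<in> multipliers B \<Longrightarrow> x + y \<in> multipliers B"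
  by (simp add: multipliers_def cstar_subalgebraD(2)[OF B] ring_distribs)

lemma multipliers_diff: "x \<in> multipliers B \<Longrightarrow> y \<in> multipliers B \<Longrightarrow> x - y \<in> multipliers B"
  by (simp add: multipliers_def cstar_subalgebra_diff[OF B] ring_distribs)

lemma multipliers_scaleC: "x \<in> multipliers B \<Longrightarrow> c *\<^sub>C x \<in> multipliers B"
  by (simp add: multipliers_def cstar_subalgebraD(3)[OF B] mult_scaleC_left mult_scaleC_right)

lemma multipliers_sum: "(\<And>i. i \<in> I \<Longrightarrow> f i \<in> multipliers B) \<Longrightarrow> sum f I \<in> multipliers B"
  by (induction I rule: infinite_finite_induct) (auto simp: multipliers_zero multipliers_add)

lemma multipliers_limit:
  assumes "\<And>n. f n \<in> multipliers B" "f \<longlonglongrightarrow> x"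
  shows "x \<in> multipliers B"
proof -
  have cl: "closed B" using B by (simp add: cstar_subalgebra_def)
  have "x * b \<in> B \<and> b * x \<in> B" if "b \<in> B" for b
    using closed_sequentially[OF cl _ tendsto_mult_right[OF assms(2), of b]]
      closed_sequentially[OF cl _ tendsto_mult_left[OF assms(2), of b]] assms(1) that
    by (auto simp: multipliers_def)
  then show ?thesis by (auto simp: multipliers_def)
qed

end

section \<open>The Neumann series\<close>

lemma summable_geometric_algebra:
  fixes x :: "'a::{real_normed_algebra_1,banach}"
  assumes "norm x < 1"
  shows "summable (\<lambda>n. x ^ n)"
proof (rule summable_comparison_test')
  show "summable (\<lambda>n. norm x ^ n)" using assms by (simp add: summable_geometric)
qed (simp add: norm_power_ineq)

lemma inverse_pair_neumann:
  fixes x :: "'a::{real_normed_algebra_1,banach}"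
  assumes "norm x < 1"
  shows "inverse_pair (1 - x) (\<Sum>n. x ^ n)"
proof -
  note s = summable_geometric_algebra[OF assms]
  have 1: "(\<Sum>n. x ^ n) = 1 + (\<Sum>n. x ^ Suc n)"
    using suminf_split_head[OF s] by (simp add: algebra_simps)
  have "(\<Sum>n. x ^ Suc n) = x * (\<Sum>n. x ^ n)" "(\<Sum>n. x ^ Suc n) = (\<Sum>n. x ^ n) * x"
    using suminf_mult[OF s, of x] suminf_mult2[OF s, of x] by (simp_all add: power_commutes)
  then show ?thesis using 1 by (simp add: inverse_pair_def algebra_simps)
qed

lemma norm_inverse_pair_le:
  fixes x y :: "'a::{real_normed_algebra_1,banach}"
  assumes "inverse_pair (1 - x) y" "norm x \<le> 1/2"
  shows "norm y \<le> 2"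
proof -
  have "y = 1 + x * y" using assms(1) by (simp add: inverse_pair_def algebra_simps)
  then have "norm y \<le> 1 + norm x * norm y"
    by (metis norm_triangle_le norm_mult_ineq norm_one add_left_mono)
  also have "\<dots> \<le> 1 + 1/2 * norm y" using assms(2) by (intro add_left_mono mult_right_mono) auto
  finally show ?thesis by simp
qed

text \<open>Pull out \<kappa> and use the Neumann series. Its partial sums are multipliers, hence so
  is the limit.\<close>

lemma multiplier_inverse:
  fixes y :: "'a::unital_cstar_algebra"
  assumes B: "cstar_subalgebra B" and y: "y \<in> multipliers B" and n: "norm y < cmod \<kappa>"
  shows "\<exists>X\<in>multipliers B. inverse_pair (\<kappa> *\<^sub>C 1 - y) X"
proof -
  have k: "\<kappa> \<noteq> 0" using n by auto
  define u where "u = inverse \<kappa> *\<^sub>C y"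
  have u: "u \<in> multipliers B" unfolding u_def using B y by (rule multipliers_scaleC)
  have nu: "norm u < 1" using n k by (simp add: u_def norm_scaleC norm_inverse norm_divide divide_simps)
  have "(\<Sum>n. u ^ n) \<in> multipliers B"
    by (rule multipliers_limit[OF B _ summable_LIMSEQ[OF summable_geometric_algebra[OF nu]]])
      (intro multipliers_sum[OF B] multipliers_power u)
  moreover have "\<kappa> *\<^sub>C (1 - u) = \<kappa> *\<^sub>C 1 - y"
    using k by (simp add: u_def scaleC_diff_right scaleC_scaleC scaleC_one)
  ultimately show ?thesis
    using inverse_pair_scaleC[OF k inverse_pair_neumann[OF nu]] multipliers_scaleC[OF B, of _ "inverse \<kappa>"]
    by auto
qed

section \<open>Spectra\<close>

text \<open>
  Writing \<open>\<zeta> - w = \<kappa> - y\<close> with \<open>\<kappa> = \<i> (Im \<zeta> + T)\<close>, the C*-identity gives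
  \<open>\<parallel>y\<parallel>\<^sup>2 \<le> T\<^sup>2 + \<parallel>Re \<zeta> - w\<parallel>\<^sup>2\<close>, which is below \<open>\<bar>\<kappa>\<bar>\<^sup>2\<close> when \<open>T * Im \<zeta>\<close> is large.
\<close>

lemma selfadjoint_resolvent:
  fixes w :: "'a::unital_cstar_algebra"
  assumes B: "cstar_subalgebra B" and w: "w \<in> multipliers B" "w\<^sup>\<star> = w" and im: "Im \<zeta> \<noteq> 0"
  shows "\<exists>X\<in>multipliers B. inverse_pair (\<zeta> *\<^sub>C 1 - w) X"
proof -
  define v where "v = complex_of_real (Re \<zeta>) *\<^sub>C 1 - w"
  \<comment> \<open>The cross term \<open>2 * (T * Im \<zeta>)\<close> becomes twice the squared
    norm of \<open>v\<close>, whatever the sign of \<open>Im \<zeta>\<close>; the square of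
    \<open>Im \<zeta>\<close> makes the inequality strict.\<close>
  define T where "T = (norm v)\<^sup>2 / Im \<zeta>"
  define y where "y = Complex 0 T *\<^sub>C 1 - v"
  have vs: "v\<^sup>\<star> = v" by (simp add: v_def star_diff star_scaleC w)
  have ys: "y\<^sup>\<star> = Complex 0 (-T) *\<^sub>C 1 - v"
    by (simp add: y_def star_diff star_scaleC vs complex_cnj)
  have "y\<^sup>\<star> * y = complex_of_real (T\<^sup>2) *\<^sub>C 1 + v * v"
  proof -
    define t where "t = Complex 0 T"
    have t: "t * t = - complex_of_real (T\<^sup>2)" "Complex 0 (-T) = - t"
      by (simp_all add: t_def complex_eq_iff power2_eq_square)
    have "y\<^sup>\<star> * y = (- (t * t)) *\<^sub>C 1 + v * v"
      unfolding ys unfolding y_def t(2) t_def[symmetric]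
      by (simp add: left_diff_distrib right_diff_distrib scaleC_scaleC scaleC_minus_left
          scaleC_minus_right scaleC_diff_right)
    then show ?thesis by (simp only: t(1) minus_minus)
  qed
  then have "(norm y)\<^sup>2 = norm (complex_of_real (T\<^sup>2) *\<^sub>C 1 + v * v)"
    using norm_star_mult_self[of y] by simp
  also have "\<dots> \<le> T\<^sup>2 + (norm v)\<^sup>2"
    using norm_triangle_ineq[of "complex_of_real (T\<^sup>2) *\<^sub>C 1" "v * v"]
    by (simp add: norm_scaleC norm_selfadjoint_square[OF vs] norm_power)
  also have "\<dots> < (Im \<zeta> + T)\<^sup>2"
  proof -
    have "T * Im \<zeta> = (norm v)\<^sup>2" using im by (simp add: T_def)
    moreover have "0 < (Im \<zeta>)\<^sup>2" using im by simp
    moreover have "(Im \<zeta> + T)\<^sup>2 = (Im \<zeta>)\<^sup>2 + 2 * (T * Im \<zeta>) + T\<^sup>2"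
      by (simp add: power2_sum)
    ultimately show ?thesis using zero_le_power2[of "norm v"] by linarith
  qed
  finally have "norm y < sqrt ((Im \<zeta> + T)\<^sup>2)" by (rule real_less_rsqrt)
  then have "norm y < cmod (Complex 0 (Im \<zeta> + T))" by (simp add: complex_norm)
  moreover have "Complex 0 (Im \<zeta> + T) *\<^sub>C 1 - y = \<zeta> *\<^sub>C 1 - w"
  proof -
    have "\<zeta> = Complex 0 (Im \<zeta> + T) - Complex 0 T + complex_of_real (Re \<zeta>)"
      by (simp add: complex_eq_iff)
    then have "\<zeta> *\<^sub>C (1::'a) = Complex 0 (Im \<zeta> + T) *\<^sub>C 1 - Complex 0 T *\<^sub>C 1 + complex_of_real (Re \<zeta>) *\<^sub>C 1"
      by (metis scaleC_add_left scaleC_diff_left)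
    then show ?thesis by (simp add: y_def v_def)
  qed
  moreover have "y \<in> multipliers B"
    unfolding y_def v_def
    by (intro multipliers_diff[OF B] multipliers_scaleC[OF B] multipliers_one w)
  ultimately show ?thesis using multiplier_inverse[OF B, of y "Complex 0 (Im \<zeta> + T)"] by simp
qed

lemma zero_in_spectrum: "0 \<in> spectrum_in B a"
  by (simp add: spectrum_in_def)

lemma spectrum_in_mono: "B \<subseteq> C \<Longrightarrow> spectrum_in C a \<subseteq> spectrum_in B a"
  unfolding spectrum_in_def by blast

text \<open>An inverse in the unitization is a scalar plus an element of \<open>B\<close>. Here the
  scalar is \<open>inverse z\<close>, and the rest is \<open>inverse z\<close> times
  \<open>X * a\<close>, which lies in \<open>B\<close> because \<open>X\<close> is a
  multiplier.\<close>

lemma not_in_spectrumI: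
  fixes a :: "'a::unital_cstar_algebra"
  assumes B: "cstar_subalgebra B" and a: "a \<in> B" and X: "X \<in> multipliers B"
    and z: "z \<noteq> 0" and inv: "inverse_pair (z *\<^sub>C 1 - a) X"
  shows "z \<notin> spectrum_in B a"
proof -
  define b where "b = X - inverse z *\<^sub>C 1"
  have Xa: "z *\<^sub>C X = 1 + X * a" "z *\<^sub>C X = 1 + a * X"
    using inv by (auto simp: inverse_pair_def algebra_simps)
  have "b = inverse z *\<^sub>C (z *\<^sub>C X - 1)"
    using z by (simp add: b_def scaleC_diff_right scaleC_scaleC scaleC_one)
  then have "b = inverse z *\<^sub>C (X * a)" using Xa(1) by simp
  then have "b \<in> B" using B multipliersD(1)[OF X a] by (simp add: cstar_subalgebra_def)
  moreover have "z *\<^sub>C b - inverse z *\<^sub>C a - a * b = 0" "z *\<^sub>C b - inverse z *\<^sub>C a - b * a = 0"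
    using Xa z by (simp_all add: b_def algebra_simps scaleC_diff_right scaleC_scaleC scaleC_one)
  ultimately show ?thesis using z unfolding spectrum_in_def
    by (auto intro!: exI[of _ "inverse z"] bexI[of _ b])
qed

text \<open>Sending \<open>(\<mu>, b)\<close> in the unitization to
  \<open>\<mu> *\<^sub>C 1 + b\<close> is a unital homomorphism into the ambient algebra, so it
  preserves inverses.\<close>

lemma unit_elem_if_not_in_spectrum:
  fixes a :: "'a::unital_cstar_algebra"
  assumes "z \<notin> spectrum_in B a"
  shows "unit_elem (z *\<^sub>C 1 - a)"
proof -
  obtain \<mu> b where *: "z * \<mu> = 1" "z *\<^sub>C b - \<mu> *\<^sub>C a - a * b = 0" "z *\<^sub>C b - \<mu> *\<^sub>C a - b * a = 0"
    using assms by (auto simp: spectrum_in_def)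
  moreover have "\<mu> * z = 1" using *(1) by (simp add: mult.commute)
  ultimately have "inverse_pair (z *\<^sub>C 1 - a) (\<mu> *\<^sub>C 1 + b)"
    by (simp add: inverse_pair_def left_diff_distrib right_diff_distrib distrib_left distrib_right
        scaleC_add_right scaleC_diff_right scaleC_scaleC scaleC_one algebra_simps)
  then show ?thesis by (auto simp: unit_elem_def)
qed

lemma unit_elem_iff_spectrum:
  fixes a :: "'a::unital_cstar_algebra"
  assumes "z \<noteq> 0"
  shows "unit_elem (z *\<^sub>C 1 - a) \<longleftrightarrow> z \<notin> spectrum_in UNIV a"
  using unit_elem_if_not_in_spectrum[of z UNIV a] not_in_spectrumI[OF cstar_subalgebra_UNIV, of a _ z] assms
  by (auto simp: unit_elem_def multipliers_def)

lemma selfadjoint_spectrum_real: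
  fixes a :: "'a::unital_cstar_algebra"
  assumes "a\<^sup>\<star> = a" "z \<in> spectrum_in UNIV a"
  shows "Im z = 0"
proof (rule ccontr)
  assume im: "Im z \<noteq> 0"
  then have "unit_elem (z *\<^sub>C 1 - a)"
    using selfadjoint_resolvent[OF cstar_subalgebra_UNIV, of a z] assms(1)
    by (auto simp: unit_elem_def multipliers_def)
  moreover have "z \<noteq> 0" using im by auto
  ultimately show False using unit_elem_iff_spectrum assms(2) by blast
qed

lemma spectrum_norm_le:
  fixes a :: "'a::unital_cstar_algebra"
  assumes "z \<in> spectrum_in UNIV a"
  shows "cmod z \<le> norm a"
proof (rule ccontr)
  assume n: "\<not> cmod z \<le> norm a"
  then have "unit_elem (z *\<^sub>C 1 - a)"
    using multiplier_inverse[OF cstar_subalgebra_UNIV, of a z] by (auto simp: unit_elem_def multipliers_def)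
  moreover have "z \<noteq> 0" using n by auto
  ultimately show False using unit_elem_iff_spectrum assms by blast
qed

text \<open>If \<open>z\<close> is not in [0, \<infinity>), its square root \<zeta> is not real, so
  \<zeta> - w and -\<zeta> - w have inverses among the multipliers, and their product is -(z - w^2).
  Using multipliers gives positivity relative to \<open>B\<close> itself.\<close>

lemma square_positive_in:
  fixes w :: "'a::unital_cstar_algebra"
  assumes B: "cstar_subalgebra B" and w: "w \<in> B" "w\<^sup>\<star> = w"
  shows "w * w \<in> positive_in B"
proof -
  have wm: "w \<in> multipliers B" using B w(1) by (rule subalgebra_multipliers)
  have wB: "w * w \<in> B" using B w by (simp add: cstar_subalgebra_def)
  have "Im z = 0 \<and> 0 \<le> Re z" if z: "z \<in> spectrum_in B (w * w)" for z
  proof (rule ccontr)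
    assume n: "\<not> (Im z = 0 \<and> 0 \<le> Re z)"
    define \<zeta> where "\<zeta> = csqrt z"
    have zz: "\<zeta> * \<zeta> = z" by (simp add: \<zeta>_def flip: power2_eq_square)
    have "Im \<zeta> \<noteq> 0"
    proof
      assume "Im \<zeta> = 0"
      then have "Im (\<zeta> * \<zeta>) = 0" "Re (\<zeta> * \<zeta>) = Re \<zeta> * Re \<zeta>" by simp_all
      then have "Im z = 0" "Re z = Re \<zeta> * Re \<zeta>" unfolding zz .
      then show False using n by simp
    qed
    then obtain X Y where XY: "X \<in> multipliers B" "inverse_pair (\<zeta> *\<^sub>C 1 - w) X"
      "Y \<in> multipliers B" "inverse_pair ((-\<zeta>) *\<^sub>C 1 - w) Y"
      using selfadjoint_resolvent[OF B wm w(2), of \<zeta>] selfadjoint_resolvent[OF B wm w(2), of "-\<zeta>"]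
      by (metis neg_equal_0_iff_equal uminus_complex.sel(2))
    have "(\<zeta> *\<^sub>C 1 - w) * ((-\<zeta>) *\<^sub>C 1 - w) = (-1) *\<^sub>C (z *\<^sub>C 1 - w * w)"
      by (simp add: algebra_simps scaleC_scaleC scaleC_minus_left scaleC_diff_right scaleC_one scaleC_minus_right flip: zz)
    then have "inverse_pair ((-1) *\<^sub>C (z *\<^sub>C 1 - w * w)) (Y * X)"
      using inverse_pair_mult[OF XY(2,4)] by simp
    then have "inverse_pair (z *\<^sub>C 1 - w * w) ((-1) *\<^sub>C (Y * X))"
      using inverse_pair_scaleC[of "-1" "(-1) *\<^sub>C (z *\<^sub>C 1 - w * w)" "Y * X"]
      by (simp add: scaleC_scaleC scaleC_one)
    moreover have "(-1) *\<^sub>C (Y * X) \<in> multipliers B"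
      using XY by (intro multipliers_scaleC[OF B] multipliers_mult)
    ultimately show False
      using not_in_spectrumI[OF B wB] z n by (metis complex.sel order_refl zero_complex.sel)
  qed
  then show ?thesis using wB by (simp add: positive_in_def star_mult w)
qed


section \<open>The norm of a self-adjoint element\<close>

text \<open>Consecutive coefficients have ratio of modulus at most 1. The binomial series below is
  thus dominated by a geometric one.\<close>

lemma abs_half_gbinomial_le_1: "\<bar>(1/2 :: real) gchoose n\<bar> \<le> 1"
proof (induction n)
  case (Suc n)
  have "(1/2 gchoose Suc n) = (1/2 - real n) / real (Suc n) * (1/2 gchoose n)"
    using gbinomial_mult_1[of "1/2 :: real" n] by (simp add: field_simps)
  then have "\<bar>(1/2 :: real) gchoose Suc n\<bar> = \<bar>1/2 - real n\<bar> / real (Suc n) * \<bar>1/2 gchoose n\<bar>"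
    by (simp add: abs_mult)
  also have "\<dots> \<le> 1 * 1" by (intro mult_mono Suc.IH) (auto simp: divide_simps)
  finally show ?case by simp
qed simp

text \<open>The square root is the binomial series of \<open>(1 - x)\<close> to the power \<open>1/2\<close>.\<close>

lemma sqrt_one_minus:
  fixes x :: "'a::unital_cstar_algebra"
  assumes x: "x\<^sup>\<star> = x" "norm x < 1"
  shows "\<exists>s. s\<^sup>\<star> = s \<and> s * s = 1 - x \<and> (\<forall>z. x * z = z * x \<longrightarrow> s * z = z * s)"
proof -
  define c where "c n = (-1) ^ n * ((1/2 :: real) gchoose n)" for n
  define f where "f n = c n *\<^sub>R x ^ n" for n
  have nf: "norm (f n) \<le> norm x ^ n" for n
  proof -
    have "norm (f n) = \<bar>c n\<bar> * norm (x ^ n)" by (simp add: f_def)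
    also have "\<dots> \<le> 1 * norm x ^ n"
      using abs_half_gbinomial_le_1 by (intro mult_mono norm_power_ineq) (auto simp: c_def abs_mult power_abs)
    finally show ?thesis by simp
  qed
  have sn: "summable (\<lambda>n. norm (f n))"
    by (rule summable_comparison_test'[OF summable_geometric[of "norm x"]]) (use x nf in auto)
  then have sf: "summable f" by (rule summable_norm_cancel)
  define s where "s = (\<Sum>n. f n)"
  \<comment> \<open>By Vandermonde the k-th Cauchy coefficient is, up to sign, the binomial
    coefficient of 1 over k, so only k = 0 and k = 1 survive.\<close>
  have conv: "(\<Sum>i\<le>k. f i * f (k - i)) = (if k = 0 then 1 else if k = 1 then - x else 0)" for k
  proof -
    have "f i * f (k - i) = ((-1) ^ k * ((1/2 gchoose i) * (1/2 gchoose (k - i)))) *\<^sub>R x ^ k" if "i \<le> k" for i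
    proof -
      have "(-1::real) ^ i * (-1) ^ (k - i) = (-1) ^ k" "x ^ i * x ^ (k - i) = x ^ k"
        using that by (simp_all flip: power_add)
      then show ?thesis by (simp add: f_def c_def mult.assoc mult.left_commute)
    qed
    then have "(\<Sum>i\<le>k. f i * f (k - i)) =
        (\<Sum>i\<le>k. ((-1) ^ k * ((1/2 gchoose i) * (1/2 gchoose (k - i)))) *\<^sub>R x ^ k)"
      by (intro sum.cong) auto
    also have "\<dots> = ((-1) ^ k * (\<Sum>i=0..k. (1/2 gchoose i) * (1/2 gchoose (k - i)))) *\<^sub>R x ^ k"
      by (simp add: sum_distrib_left atMost_atLeast0 flip: scaleR_sum_left)
    also have "\<dots> = ((-1) ^ k * (of_nat 1 gchoose k)) *\<^sub>R x ^ k"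
      by (simp add: gbinomial_Vandermonde)
    also have "\<dots> = ((-1) ^ k * of_nat (1 choose k)) *\<^sub>R x ^ k"
      by (simp only: binomial_gbinomial)
    also have "\<dots> = (if k = 0 then 1 else if k = 1 then - x else 0)"
      by (auto simp: binomial_eq_0)
    finally show ?thesis .
  qed
  have "(\<lambda>k. \<Sum>i\<le>k. f i * f (k - i)) sums (s * s)"
    unfolding s_def by (rule Cauchy_product_sums[OF sn sn])
  moreover have "(\<lambda>k. \<Sum>i\<le>k. f i * f (k - i)) sums (\<Sum>k\<in>{0,1}. \<Sum>i\<le>k. f i * f (k - i))"
    by (rule sums_finite) (auto simp: conv)
  ultimately have "s * s = (\<Sum>k\<in>{0,1}. \<Sum>i\<le>k. f i * f (k - i))" by (rule sums_unique2)
  then have "s * s = 1 - x" by (simp only: conv) simp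
  moreover have "s\<^sup>\<star> = s"
  proof -
    have "s\<^sup>\<star> = (\<Sum>n. (f n)\<^sup>\<star>)" unfolding s_def by (rule bounded_linear.suminf[OF bounded_linear_star sf])
    then show ?thesis by (simp add: s_def f_def star_scaleR star_power x)
  qed
  moreover have "s * z = z * s" if "x * z = z * x" for z
  proof -
    have "x ^ n * z = z * x ^ n" for n
      by (rule power_commuting_commutes) (use that in simp)
    then have "f n * z = z * f n" for n by (simp add: f_def)
    then show ?thesis
      unfolding s_def using suminf_mult[OF sf, of z] suminf_mult2[OF sf, of z] by simp
  qed
  ultimately show ?thesis by blast
qed

text \<open>By commutation the right-hand side is the squared norm of \<open>u\<close>, and
  \<open>b\<close> is the average of \<open>u\<close> and its adjoint. This stands in for
  monotonicity of the norm on positive elements.\<close>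

lemma norm_le_sum_of_squares:
  fixes b g :: "'a::unital_cstar_algebra"
  assumes sa: "b\<^sup>\<star> = b" "g\<^sup>\<star> = g" and com: "b * g = g * b"
  shows "(norm b)\<^sup>2 \<le> norm (b * b + g * g)"
proof -
  define u where "u = b + \<i> *\<^sub>C g"
  have us: "u\<^sup>\<star> = b - \<i> *\<^sub>C g"
    by (simp add: u_def star_add star_scaleC sa scaleC_minus_left)
  have "u\<^sup>\<star> * u = b * b + g * g"
    unfolding us unfolding u_def
    by (simp add: algebra_simps mult_scaleC_left mult_scaleC_right scaleC_scaleC com scaleC_minus_one scaleC_diff_right)
  then have "norm (b * b + g * g) = (norm u)\<^sup>2" using norm_star_mult_self[of u] by simp
  moreover have "norm b \<le> norm u"
  proof -
    have "2 *\<^sub>R b = u + u\<^sup>\<star>" unfolding us by (simp add: u_def scaleR_2)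
    then have "2 * norm b \<le> norm u + norm (u\<^sup>\<star>)"
      by (metis norm_scaleR norm_triangle_ineq abs_numeral)
    then show ?thesis by simp
  qed
  ultimately show ?thesis by (simp add: power_mono)
qed

text \<open>
  With \<open>s\<close> and \<open>e\<close> the square roots of \<open>1 - b\<^sup>2\<close> and \<open>1 - d/D\<close>, the elements \<open>b\<close> and \<open>s e\<close> commute
  and the sum of their squares is the scalar \<open>1 - 1/D\<close>.
\<close>

lemma norm_le_if_inverse_bounded:
  fixes b d :: "'a::unital_cstar_algebra"
  assumes b: "b\<^sup>\<star> = b" "norm b < 1" and d: "inverse_pair (1 - b * b) d" "norm d < D" "1 \<le> D"
  shows "(norm b)\<^sup>2 \<le> 1 - 1 / D"
proof -
  have D: "D > 0" using d by simp
  have bs: "(b * b)\<^sup>\<star> = b * b" by (simp add: star_mult b)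
  have "norm (b * b) < 1"
    using b by (simp add: norm_selfadjoint_square power_less_one_iff)
  then obtain s where s: "s\<^sup>\<star> = s" "s * s = 1 - b * b" "\<And>z. b * b * z = z * (b * b) \<Longrightarrow> s * z = z * s"
    using sqrt_one_minus[OF bs] by blast
  have ds: "d\<^sup>\<star> = d" by (rule inverse_pair_selfadjoint[OF d(1)]) (simp add: star_diff bs)
  have "((1/D) *\<^sub>R d)\<^sup>\<star> = (1/D) *\<^sub>R d" "norm ((1/D) *\<^sub>R d) < 1"
    using d D by (simp_all add: star_scaleR ds)
  then obtain e where e: "e\<^sup>\<star> = e" "e * e = 1 - (1/D) *\<^sub>R d"
    "\<And>z. (1/D) *\<^sub>R d * z = z * ((1/D) *\<^sub>R d) \<Longrightarrow> e * z = z * e"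
    using sqrt_one_minus by blast
  have db: "d * z = z * d" if "b * b * z = z * (b * b)" for z
    by (rule inverse_pair_commute[OF d(1)]) (use that in \<open>simp add: algebra_simps\<close>)
  have sb: "s * b = b * s" by (rule s) (simp add: mult.assoc)
  have sd: "s * d = d * s" by (rule s) (simp flip: db)
  have eb: "e * b = b * e" by (rule e) (simp add: db mult.assoc)
  have es: "e * s = s * e" by (rule e) (simp add: sd)
  define g where "g = s * e"
  have "g * g = (s * s) * (e * e)" by (metis g_def es mult.assoc)
  also have "\<dots> = (1 - b * b) - (1/D) *\<^sub>R ((1 - b * b) * d)"
    by (simp add: s e right_diff_distrib)
  finally have gg: "b * b + g * g = (1 - 1/D) *\<^sub>R 1"
    using d(1) by (simp add: inverse_pair_def scaleR_left_diff_distrib)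
  have "g\<^sup>\<star> = g" by (simp add: g_def star_mult s e es)
  moreover have "b * g = g * b" by (metis g_def sb eb mult.assoc)
  ultimately have "(norm b)\<^sup>2 \<le> norm ((1 - 1/D) *\<^sub>R (1::'a))"
    using norm_le_sum_of_squares[OF b(1), of g] gg by simp
  then show ?thesis using d by simp
qed

text \<open>The preceding bound needs norm below 1, so it is applied to r b with r slightly below 1.
  The inverse of 1 - (r b)^2 still has norm below \<open>D\<close>, which yields 1 - t \<le> 1 - 2
  t.\<close>

lemma one_minus_square_not_unit:
  fixes b :: "'a::unital_cstar_algebra"
  assumes b: "b\<^sup>\<star> = b" "norm b = 1"
  shows "\<not> unit_elem (1 - b * b)"
proof
  assume "unit_elem (1 - b * b)"
  then obtain d where d: "inverse_pair (1 - b * b) d" by (auto simp: unit_elem_def)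
  define D where "D = 2 * norm d + 1"
  have D: "1 \<le> D" "norm d \<le> D" by (simp_all add: D_def)
  \<comment> \<open>Small enough for the Neumann series, which needs
    \<open>t * norm d \<le> 1/2\<close>, and for the contradiction, which needs
    \<open>t < 1 / D\<close>.\<close>
  define t where "t = 1 / (2 * D)"
  have t: "0 < t" "t < 1" "t * norm d \<le> 1/2"
    using D by (simp_all add: t_def divide_simps)
  define r where "r = sqrt (1 - t)"
  have r: "0 \<le> r" "r < 1" "r * r = 1 - t" using t by (auto simp: r_def)
  \<comment> \<open>Chosen so that 1 - (r b)^2 = (1 - b^2) + t b^2 splits off the factor 1 - b^2,
    with inverse \<open>d\<close>.\<close>
  define x where "x = - (t *\<^sub>R (d * (b * b)))"
  have bb: "norm (b * b) = 1" using b by (simp add: norm_selfadjoint_square)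
  have "norm x \<le> t * norm d"
    using norm_mult_ineq[of d "b * b"] bb t by (simp add: x_def mult_left_mono)
  then have x: "norm x \<le> 1/2" "norm x < 1" using t by linarith+
  define X where "X = (\<Sum>n. x ^ n)"
  have X: "inverse_pair (1 - x) X" unfolding X_def by (rule inverse_pair_neumann[OF x(2)])
  have "1 - (r *\<^sub>R b) * (r *\<^sub>R b) = (1 - b * b) * (1 - x)"
  proof -
    have "(1 - b * b) * (1 - x) = 1 - b * b + t *\<^sub>R ((1 - b * b) * d * (b * b))"
      by (simp add: x_def distrib_left mult.assoc)
    then show ?thesis using d by (simp add: inverse_pair_def r scaleR_left_diff_distrib)
  qed
  then have inv: "inverse_pair (1 - (r *\<^sub>R b) * (r *\<^sub>R b)) (X * d)"
    using inverse_pair_mult[OF d X] by simp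
  have "norm (X * d) \<le> 2 * norm d"
    using norm_mult_ineq[of X d] mult_right_mono[OF norm_inverse_pair_le[OF X x(1)], of "norm d"] by simp
  then have "(norm (r *\<^sub>R b))\<^sup>2 \<le> 1 - 1 / D"
    by (intro norm_le_if_inverse_bounded[OF _ _ inv]) (use b r in \<open>auto simp: star_scaleR D_def\<close>)
  then have "1 - t \<le> 1 - 1 / D" using r b by (simp add: power2_eq_square)
  moreover have "1 / D = 2 * t" by (simp add: t_def)
  ultimately show False using t(1) by linarith
qed


section \<open>Polynomial functional calculus\<close>

text \<open>Complex coefficients are allowed so that polynomials split into linear factors.\<close>

definition poly_at :: "complex poly \<Rightarrow> 'a::unital_cstar_algebra \<Rightarrow> 'a" where
  "poly_at p a = fold_coeffs (\<lambda>c y. c *\<^sub>C 1 + a * y) p 0"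

lemma poly_at_0 [simp]: "poly_at 0 a = 0"
  by (simp add: poly_at_def)

lemma poly_at_pCons [simp]: "poly_at (pCons c p) a = c *\<^sub>C 1 + a * poly_at p a"
  by (cases "p = 0 \<and> c = 0") (auto simp: poly_at_def)

lemma poly_at_1 [simp]: "poly_at 1 a = 1"
  by (simp add: one_pCons scaleC_one)

lemma poly_at_add [simp]: "poly_at (p + q) a = poly_at p a + poly_at q a"
  by (induction p q rule: poly_induct2) (simp_all add: scaleC_add_left algebra_simps)

lemma poly_at_smult [simp]: "poly_at (smult c p) a = c *\<^sub>C poly_at p a"
  by (induction p) (simp_all add: scaleC_add_right scaleC_scaleC mult_scaleC_right)

lemma poly_at_minus [simp]: "poly_at (- p) a = - poly_at p a"
  using poly_at_smult[of "-1" p a] by (simp add: scaleC_minus_one)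

lemma poly_at_diff [simp]: "poly_at (p - q) a = poly_at p a - poly_at q a"
  using poly_at_add[of p "-q" a] by simp

lemma poly_at_mult [simp]: "poly_at (p * q) a = poly_at p a * poly_at q a"
  by (induction p) (simp_all add: distrib_right mult.assoc)

lemma star_poly_at:
  assumes "a\<^sup>\<star> = a"
  shows "(poly_at p a)\<^sup>\<star> = poly_at (map_poly cnj p) a"
proof -
  have com: "poly_at q a * a = a * poly_at q a" for q
    by (induction q) (simp_all add: distrib_left distrib_right mult.assoc)
  show ?thesis
    by (induction p) (simp_all add: map_poly_pCons star_add star_scaleC star_mult assms com)
qed

lemma poly_at_multipliers:
  assumes "cstar_subalgebra B" "a \<in> multipliers B"
  shows "poly_at p a \<in> multipliers B"
  by (induction p)
    (auto intro!: multipliers_add multipliers_scaleC multipliers_mult multipliers_one multipliers_zero assms)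

text \<open>One half of spectral mapping: no root of \<open>q\<close> lies in the spectrum, so every
  linear factor is invertible at \<open>a\<close>; the induction splits them off one by one.\<close>

lemma unit_elem_poly_at:
  assumes "q \<noteq> 0" "\<And>z. z \<in> spectrum_in UNIV a \<Longrightarrow> poly q z \<noteq> 0"
  shows "unit_elem (poly_at q a)"
  using assms
proof (induction "degree q" arbitrary: q)
  case 0
  then obtain c where "q = [:c:]" "c \<noteq> 0" by (metis degree_eq_zeroE pCons_0_0)
  moreover have "unit_elem (1::'a)" by (auto simp: unit_elem_def inverse_pair_def)
  ultimately show ?case using unit_elem_scaleC[of c 1] by simp
next
  case (Suc n)
  then have "\<not> constant (poly q)" by (simp add: constant_degree)
  then obtain z where z: "poly q z = 0" using fundamental_theorem_of_algebra by blast
  then obtain q' where q': "q = [:- z, 1:] * q'" by (metis dvdE poly_eq_0_iff_dvd)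
  have "q' \<noteq> 0" using q' Suc.prems(1) by auto
  then have "degree q = Suc (degree q')" unfolding q' by (subst degree_mult_eq) auto
  then have "unit_elem (poly_at q' a)"
    using Suc.hyps Suc.prems(2) \<open>q' \<noteq> 0\<close> by (auto simp: q')
  moreover have "unit_elem ((-1) *\<^sub>C (z *\<^sub>C 1 - a))"
    using Suc.prems(2) z by (intro unit_elem_scaleC unit_elem_if_not_in_spectrum[of z UNIV]) auto
  then have "unit_elem (poly_at [:- z, 1:] a)"
    by (simp add: scaleC_minus_one scaleC_minus_left scaleC_one)
  ultimately show ?case unfolding q' poly_at_mult by (rule unit_elem_mult[rotated])
qed

section \<open>Real polynomials of a self-adjoint element and their norms\<close>

definition rpoly_at :: "real poly \<Rightarrow> 'a::unital_cstar_algebra \<Rightarrow> 'a" where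
  "rpoly_at p a = poly_at (map_poly complex_of_real p) a"

lemma poly_map_poly_of_real:
  "poly (map_poly complex_of_real p) (complex_of_real t) = complex_of_real (poly p t)"
  by (induction p) (auto simp: map_poly_pCons)

lemma rpoly_at_pCons [simp]: "rpoly_at (pCons c p) a = c *\<^sub>R 1 + a * rpoly_at p a"
  by (simp add: rpoly_at_def map_poly_pCons scaleR_scaleC)

lemma rpoly_at_0 [simp]: "rpoly_at 0 a = 0"
  by (simp add: rpoly_at_def)

lemma rpoly_at_diff [simp]: "rpoly_at (p - q) a = rpoly_at p a - rpoly_at q a"
proof -
  have "map_poly complex_of_real (p - q) = map_poly complex_of_real p - map_poly complex_of_real q"
    by (rule poly_eqI) (simp add: coeff_map_poly)
  then show ?thesis by (simp add: rpoly_at_def)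
qed

lemma map_poly_of_real_mult:
  "map_poly complex_of_real (p * q) = map_poly complex_of_real p * map_poly complex_of_real q"
  by (rule poly_eqI) (simp add: coeff_map_poly coeff_mult)

lemma rpoly_at_mult [simp]: "rpoly_at (p * q) a = rpoly_at p a * rpoly_at q a"
  by (simp add: rpoly_at_def map_poly_of_real_mult)

lemma star_rpoly_at: "a\<^sup>\<star> = a \<Longrightarrow> (rpoly_at p a)\<^sup>\<star> = rpoly_at p a"
  by (simp add: rpoly_at_def star_poly_at map_poly_map_poly o_def)

lemma rpoly_at_multipliers:
  "cstar_subalgebra B \<Longrightarrow> a \<in> multipliers B \<Longrightarrow> rpoly_at p a \<in> multipliers B"
  by (simp add: rpoly_at_def poly_at_multipliers)

lemma rpoly_at_sum:
  "degree p \<le> n \<Longrightarrow> rpoly_at p a = (\<Sum>i\<le>n. coeff p i *\<^sub>R a ^ i)"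
proof (induction p arbitrary: n)
  case (pCons c p)
  show ?case
  proof (cases n)
    case 0
    then have "p = 0" using pCons.prems by (auto simp: degree_pCons_eq_if split: if_splits)
    then show ?thesis using 0 by simp
  next
    case (Suc k)
    then have "degree p \<le> k" using pCons.prems by (auto simp: degree_pCons_eq_if split: if_splits)
    then show ?thesis unfolding Suc using pCons.IH[of k]
      by (simp add: sum.atMost_Suc_shift sum_distrib_left del: sum.atMost_Suc)
  qed
qed simp

lemma poly_pCons_0: "poly (pCons 0 p) = (\<lambda>t. t * poly p (t :: real))"
  by (rule ext) simp

lemma poly_no_const_eq: "poly_no_const p a = rpoly_at (pCons 0 p) a"
proof -
  have "((*) a ^^ i) a = a * a ^ i" for i
    by (induction i) simp_all
  then show ?thesis
    by (simp add: poly_no_const_def rpoly_at_sum[of p "degree p"] sum_distrib_left)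
qed

text \<open>Scale p(a) to an element \<open>b\<close> of norm 1. As \<open>1 - b * b\<close> is not
  invertible, the polynomial \<open>q\<close> producing it vanishes somewhere on the spectrum, and
  there the modulus of \<open>p\<close> is the norm of p(a).\<close>

lemma norm_rpoly_at_le:
  fixes a :: "'a::unital_cstar_algebra"
  assumes a: "a\<^sup>\<star> = a"
    and M: "\<And>t. complex_of_real t \<in> spectrum_in UNIV a \<Longrightarrow> \<bar>poly p t\<bar> \<le> M"
  shows "norm (rpoly_at p a) \<le> M"
proof (cases "rpoly_at p a = 0")
  case True
  \<comment> \<open>0 always counts as a spectral point, which forces \<open>M\<close> to be
    nonnegative.\<close>
  then show ?thesis using M[of 0] zero_in_spectrum[of UNIV a] by auto
next
  case False
  define N where "N = norm (rpoly_at p a)"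
  define P where "P = map_poly complex_of_real p"
  have N: "N > 0" using False by (simp add: N_def)
  define b where "b = (1 / N) *\<^sub>R rpoly_at p a"
  have b: "b\<^sup>\<star> = b" "norm b = 1" using N by (simp_all add: b_def star_scaleR star_rpoly_at a) (simp add: N_def)
  define q where "q = 1 - smult (1 / complex_of_real (N\<^sup>2)) (P * P)"
  have "poly_at q a = 1 - b * b"
    by (simp add: q_def b_def P_def rpoly_at_def scaleR_scaleC scaleC_scaleC
        power2_eq_square mult_scaleC_left mult_scaleC_right)
  then have "\<not> unit_elem (poly_at q a)" using one_minus_square_not_unit[OF b] by simp
  moreover have "unit_elem (0::'a) = False" by (simp add: unit_elem_def inverse_pair_def)
  \<comment> \<open>If \<open>q\<close> is the zero polynomial, 0 serves as
    \<open>z\<close>.\<close>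
  ultimately obtain z where z: "z \<in> spectrum_in UNIV a" "poly q z = 0"
    using unit_elem_poly_at[of q a] zero_in_spectrum[of UNIV a] by (metis poly_0)
  define t where "t = Re z"
  have zt: "z = complex_of_real t"
    using selfadjoint_spectrum_real[OF a z(1)] by (simp add: t_def complex_eq_iff)
  have "complex_of_real ((poly p t)\<^sup>2) = complex_of_real (N\<^sup>2)"
    using z(2) N unfolding q_def zt P_def
    by (simp add: poly_map_poly_of_real field_simps power2_eq_square)
  then have "(poly p t)\<^sup>2 = N\<^sup>2" by (simp only: of_real_eq_iff)
  then have "\<bar>poly p t\<bar> = N" using N by (auto simp: power2_eq_iff)
  then show ?thesis using M[of t] z(1) zt N_def by simp
qed

section \<open>Continuous functional calculus\<close>

text \<open>A formal polynomial, so that it can be evaluated in the algebra. It samples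
  \<open>f\<close> only on [0, 1] and does not depend on the element.\<close>

definition bernstein_poly :: "(real \<Rightarrow> real) \<Rightarrow> nat \<Rightarrow> real poly" where
  "bernstein_poly f n =
     (\<Sum>k\<le>n. smult (f (real k / real n) * real (n choose k)) ([:0, 1:] ^ k * [:1, -1:] ^ (n - k)))"

lemma bernstein_poly_approximation:
  assumes "continuous_on {0..1} f" "0 < e"
  obtains N where "\<And>n t. n \<ge> N \<Longrightarrow> t \<in> {0..1} \<Longrightarrow> \<bar>poly (bernstein_poly f n) t - f t\<bar> < e"
proof -
  have "poly (bernstein_poly f n) t = (\<Sum>k\<le>n. f (real k / real n) * Bernstein n k t)" for n t
    by (simp add: bernstein_poly_def poly_sum Bernstein_def mult.assoc)
  moreover obtain N where "\<forall>n t. N \<le> n \<and> t \<in> {0..1} \<longrightarrow>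
      \<bar>f t - (\<Sum>k\<le>n. f (real k / real n) * Bernstein n k t)\<bar> < e"
    using Bernstein_Weierstrass[OF assms] by blast
  ultimately show ?thesis using that[of N] by (simp add: abs_minus_commute)
qed

lemma uniform_limit_bernstein_poly:
  assumes "continuous_on {0..1} f"
  shows "uniform_limit {0..1} (\<lambda>n. poly (bernstein_poly f n)) f sequentially"
proof (rule uniform_limitI)
  fix e :: real assume "0 < e"
  obtain N where "\<And>n t. n \<ge> N \<Longrightarrow> t \<in> {0..1} \<Longrightarrow> \<bar>poly (bernstein_poly f n) t - f t\<bar> < e"
    using bernstein_poly_approximation[OF assms \<open>0 < e\<close>] by blast
  then show "\<forall>\<^sub>F n in sequentially. \<forall>x\<in>{0..1}. dist (poly (bernstein_poly f n) x) (f x) < e"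
    unfolding eventually_sequentially dist_real_def by blast
qed

definition cfc :: "(real \<Rightarrow> real) \<Rightarrow> 'a::unital_cstar_algebra \<Rightarrow> 'a" where
  "cfc f a = lim (\<lambda>n. rpoly_at (bernstein_poly f n) a)"

locale unit_interval_element =
  fixes a :: "'a::unital_cstar_algebra"
  assumes selfadjoint: "a\<^sup>\<star> = a"
    and spectrum: "\<And>t. complex_of_real t \<in> spectrum_in UNIV a \<Longrightarrow> t \<in> {0..1}"
begin

abbreviation real_spectrum :: "real set" where
  "real_spectrum \<equiv> {t. complex_of_real t \<in> spectrum_in UNIV a}"

lemma rpoly_at_diff_tendsto_0:
  assumes "uniform_limit real_spectrum (\<lambda>n. poly (p n)) f sequentially"
    and "uniform_limit real_spectrum (\<lambda>n. poly (q n)) f sequentially"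
  shows "(\<lambda>n. rpoly_at (p n) a - rpoly_at (q n) a) \<longlonglongrightarrow> 0"
proof (rule LIMSEQ_I)
  fix e :: real assume "0 < e"
  have "uniform_limit real_spectrum (\<lambda>n t. poly (p n) t - poly (q n) t) (\<lambda>t. f t - f t) sequentially"
    using assms by (rule uniform_limit_minus)
  from uniform_limitD[OF this, of "e / 2"] \<open>0 < e\<close>
  obtain N where N: "\<And>n t. n \<ge> N \<Longrightarrow> t \<in> real_spectrum \<Longrightarrow> \<bar>poly (p n) t - poly (q n) t\<bar> < e / 2"
    by (auto simp: eventually_sequentially)
  have "norm (rpoly_at (p n - q n) a) \<le> e / 2" if "n \<ge> N" for n
    by (rule norm_rpoly_at_le[OF selfadjoint]) (use N[OF that] in \<open>auto intro: less_imp_le\<close>)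
  then show "\<exists>N. \<forall>n\<ge>N. norm (rpoly_at (p n) a - rpoly_at (q n) a - 0) < e"
    using \<open>0 < e\<close> by (intro exI[of _ N]) (force)
qed

lemma bernstein_tendsto_cfc:
  assumes "continuous_on {0..1} f"
  shows "(\<lambda>n. rpoly_at (bernstein_poly f n) a) \<longlonglongrightarrow> cfc f a"
proof -
  have "Cauchy (\<lambda>n. rpoly_at (bernstein_poly f n) a)"
  proof (rule metric_CauchyI)
    fix e :: real assume "0 < e"
    obtain N where N: "\<And>n t. n \<ge> N \<Longrightarrow> t \<in> {0..1} \<Longrightarrow> \<bar>poly (bernstein_poly f n) t - f t\<bar> < e / 4"
      using bernstein_poly_approximation[OF assms, of "e / 4"] \<open>0 < e\<close> by auto
    have "norm (rpoly_at (bernstein_poly f m - bernstein_poly f n) a) \<le> e / 2" if "m \<ge> N" "n \<ge> N" for m n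
    proof (rule norm_rpoly_at_le[OF selfadjoint])
      fix t assume "complex_of_real t \<in> spectrum_in UNIV a"
      then have "t \<in> {0..1}" by (rule spectrum)
      from N[OF that(1) this] N[OF that(2) this]
      show "\<bar>poly (bernstein_poly f m - bernstein_poly f n) t\<bar> \<le> e / 2"
        unfolding poly_diff by linarith
    qed
    then show "\<exists>N. \<forall>m\<ge>N. \<forall>n\<ge>N. dist (rpoly_at (bernstein_poly f m) a) (rpoly_at (bernstein_poly f n) a) < e"
      using \<open>0 < e\<close> by (intro exI[of _ N]) (force simp: dist_norm)
  qed
  then show ?thesis unfolding cfc_def by (simp add: Cauchy_convergent_iff convergent_LIMSEQ_iff)
qed

text \<open>By the norm bound, polynomial sequences with the same uniform limit on the spectrum have
  the same limit in the algebra. The rules below follow by picking a sequence: a constant one for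
  polynomials, termwise differences or products of Bernstein polynomials otherwise.\<close>

lemma rpoly_at_tendsto_cfc:
  assumes f: "continuous_on {0..1} f"
    and p: "uniform_limit real_spectrum (\<lambda>n. poly (p n)) f sequentially"
  shows "(\<lambda>n. rpoly_at (p n) a) \<longlonglongrightarrow> cfc f a"
proof -
  have "uniform_limit real_spectrum (\<lambda>n. poly (bernstein_poly f n)) f sequentially"
    by (rule uniform_limit_on_subset[OF uniform_limit_bernstein_poly[OF f]]) (use spectrum in auto)
  from tendsto_add[OF rpoly_at_diff_tendsto_0[OF p this] bernstein_tendsto_cfc[OF f]]
  show ?thesis by simp
qed

lemma cfc_poly: "cfc (poly p) a = rpoly_at p a"
proof (rule LIMSEQ_unique[OF _ tendsto_const])
  show "(\<lambda>_. rpoly_at p a) \<longlonglongrightarrow> cfc (poly p) a"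
    by (rule rpoly_at_tendsto_cfc) (auto intro!: uniform_limit_const continuous_intros)
qed

lemma cfc_diff:
  assumes f: "continuous_on {0..1} f" and g: "continuous_on {0..1} g"
  shows "cfc (\<lambda>t. f t - g t) a = cfc f a - cfc g a"
proof -
  have "uniform_limit {0..1} (\<lambda>n. poly (bernstein_poly f n - bernstein_poly g n)) (\<lambda>t. f t - g t) sequentially"
    using uniform_limit_minus[OF uniform_limit_bernstein_poly[OF f] uniform_limit_bernstein_poly[OF g]]
    by (simp flip: poly_diff)
  then have "uniform_limit real_spectrum (\<lambda>n. poly (bernstein_poly f n - bernstein_poly g n)) (\<lambda>t. f t - g t) sequentially"
    by (rule uniform_limit_on_subset) (use spectrum in auto)
  from rpoly_at_tendsto_cfc[OF _ this]
  have "(\<lambda>n. rpoly_at (bernstein_poly f n - bernstein_poly g n) a) \<longlonglongrightarrow> cfc (\<lambda>t. f t - g t) a"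
    using f g by (simp add: continuous_on_diff)
  moreover have "(\<lambda>n. rpoly_at (bernstein_poly f n - bernstein_poly g n) a) \<longlonglongrightarrow> cfc f a - cfc g a"
    using tendsto_diff[OF bernstein_tendsto_cfc[OF f] bernstein_tendsto_cfc[OF g]] by simp
  ultimately show ?thesis by (rule LIMSEQ_unique)
qed

lemma cfc_mult:
  assumes f: "continuous_on {0..1} f" and g: "continuous_on {0..1} g"
  shows "cfc (\<lambda>t. f t * g t) a = cfc f a * cfc g a"
proof -
  have bd: "bounded (h ` {0..1})" if "continuous_on {0..1} h" for h :: "real \<Rightarrow> real"
    by (rule compact_imp_bounded[OF compact_continuous_image[OF that]]) simp
  have "uniform_limit {0..1} (\<lambda>n. poly (bernstein_poly f n * bernstein_poly g n)) (\<lambda>t. f t * g t) sequentially"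
    using uniform_lim_mult[OF uniform_limit_bernstein_poly[OF f] uniform_limit_bernstein_poly[OF g] bd[OF f] bd[OF g]]
    by (simp flip: poly_mult)
  then have "uniform_limit real_spectrum (\<lambda>n. poly (bernstein_poly f n * bernstein_poly g n)) (\<lambda>t. f t * g t) sequentially"
    by (rule uniform_limit_on_subset) (use spectrum in auto)
  from rpoly_at_tendsto_cfc[OF _ this]
  have "(\<lambda>n. rpoly_at (bernstein_poly f n * bernstein_poly g n) a) \<longlonglongrightarrow> cfc (\<lambda>t. f t * g t) a"
    using f g by (simp add: continuous_on_mult)
  moreover have "(\<lambda>n. rpoly_at (bernstein_poly f n * bernstein_poly g n) a) \<longlonglongrightarrow> cfc f a * cfc g a"
    using tendsto_mult[OF bernstein_tendsto_cfc[OF f] bernstein_tendsto_cfc[OF g]] by simp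
  ultimately show ?thesis by (rule LIMSEQ_unique)
qed

lemma cfc_cong:
  assumes "\<And>t. t \<in> {0..1} \<Longrightarrow> f t = g t"
  shows "cfc f a = cfc g a"
proof -
  \<comment> \<open>All sample points k/n lie in [0, 1]; for n = 0 the quotient is 0 by
    convention.\<close>
  have "bernstein_poly f = bernstein_poly g"
    unfolding bernstein_poly_def
    by (intro ext sum.cong refl arg_cong2[where f = smult] arg_cong2[where f = times] assms)
      (auto simp: divide_simps)
  then show ?thesis by (simp add: cfc_def)
qed

lemma cfc_const_1: "cfc (\<lambda>_. 1) a = 1"
  using cfc_poly[of "[:1:]"] cfc_cong[of "\<lambda>_. 1" "poly [:1:]"] by simp

lemma cfc_ident: "cfc (\<lambda>t. t) a = a"
  using cfc_poly[of "[:0, 1:]"] cfc_cong[of "\<lambda>t. t" "poly [:0, 1:]"] by simp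

lemma star_cfc:
  assumes "continuous_on {0..1} f"
  shows "(cfc f a)\<^sup>\<star> = cfc f a"
  using tendsto_star[OF bernstein_tendsto_cfc[OF assms]] bernstein_tendsto_cfc[OF assms]
  by (simp add: star_rpoly_at selfadjoint LIMSEQ_unique)

lemma norm_cfc_le:
  assumes f: "continuous_on {0..1} f" and M: "\<And>t. t \<in> {0..1} \<Longrightarrow> \<bar>f t\<bar> \<le> M"
  shows "norm (cfc f a) \<le> M"
proof (rule field_le_epsilon)
  fix e :: real assume "0 < e"
  obtain N where N: "\<And>n t. n \<ge> N \<Longrightarrow> t \<in> {0..1} \<Longrightarrow> \<bar>poly (bernstein_poly f n) t - f t\<bar> < e"
    using bernstein_poly_approximation[OF f \<open>0 < e\<close>] by blast
  have "norm (rpoly_at (bernstein_poly f n) a) \<le> M + e" if "n \<ge> N" for n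
  proof (rule norm_rpoly_at_le[OF selfadjoint])
    fix t assume "complex_of_real t \<in> spectrum_in UNIV a"
    then have "t \<in> {0..1}" by (rule spectrum)
    from N[OF that this] M[OF this] show "\<bar>poly (bernstein_poly f n) t\<bar> \<le> M + e" by linarith
  qed
  then show "norm (cfc f a) \<le> M + e"
    by (intro LIMSEQ_le_const2[OF tendsto_norm[OF bernstein_tendsto_cfc[OF f]]]) auto
qed

text \<open>As \<open>f\<close> may be nonzero at 0, the value need not lie in \<open>B\<close>; in
  the final proof a factor \<open>r\<^sub>0\<close> moves it there.\<close>

lemma cfc_multipliers:
  assumes "cstar_subalgebra B" "a \<in> multipliers B" "continuous_on {0..1} f"
  shows "cfc f a \<in> multipliers B"
  by (rule multipliers_limit[OF assms(1) _ bernstein_tendsto_cfc[OF assms(3)]])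
    (rule rpoly_at_multipliers[OF assms(1,2)])

text \<open>
  Subtracting the value at \<open>0\<close> from the Bernstein polynomials gives polynomials without constant
  term, so that the description of the calculus used in \<^const>\<open>cont_fun_calc\<close> is not vacuous.
\<close>

lemma cont_fun_calc_eq_cfc:
  assumes f: "continuous_on {0..1} f" "f 0 = 0"
  shows "cont_fun_calc f a = cfc f a"
  unfolding cont_fun_calc_def
proof (rule the_equality)
  define s where "s n = bernstein_poly f n - [:poly (bernstein_poly f n) 0:]" for n
  have "\<exists>p. s n = pCons 0 p" for n
  proof -
    obtain c p where cp: "s n = pCons c p" by (cases "s n")
    moreover have "poly (s n) 0 = 0" by (simp add: s_def)
    ultimately show ?thesis by auto
  qed
  then obtain p where p: "\<And>n. s n = pCons 0 (p n)" by metis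
  have "uniform_limit real_spectrum (\<lambda>n. poly (s n)) f sequentially"
  proof (rule uniform_limitI)
    fix e :: real assume "0 < e"
    \<comment> \<open>The errors at \<open>t\<close> and at 0, where \<open>f\<close> vanishes, add
      up once the constant term is subtracted; hence the halves.\<close>
    have "\<forall>\<^sub>F n in sequentially. \<forall>t\<in>{0..1}. dist (poly (bernstein_poly f n) t) (f t) < e / 2"
      using uniform_limitD[OF uniform_limit_bernstein_poly[OF f(1)], of "e / 2"] \<open>0 < e\<close> by simp
    then show "\<forall>\<^sub>F n in sequentially. \<forall>t\<in>real_spectrum. dist (poly (s n) t) (f t) < e"
    proof (rule eventually_mono, intro ballI)
      fix n t
      assume *: "\<forall>t\<in>{0..1}. dist (poly (bernstein_poly f n) t) (f t) < e / 2" and "t \<in> real_spectrum"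
      then have "t \<in> {0..1}" using spectrum by simp
      then have "\<bar>poly (bernstein_poly f n) t - f t\<bar> < e / 2" "\<bar>poly (bernstein_poly f n) 0 - f 0\<bar> < e / 2"
        using * by (auto simp: dist_real_def)
      moreover have "poly (s n) t = poly (bernstein_poly f n) t - poly (bernstein_poly f n) 0"
        by (simp add: s_def)
      ultimately show "dist (poly (s n) t) (f t) < e"
        unfolding dist_real_def f(2) by linarith
    qed
  qed
  then show "\<exists>p. uniform_limit real_spectrum (\<lambda>n t. t * poly (p n) t) f sequentially \<and>
      (\<lambda>n. poly_no_const (p n) a) \<longlonglongrightarrow> cfc f a"
    using rpoly_at_tendsto_cfc[OF f(1), of s]
    by (intro exI[of _ p]) (simp add: p poly_no_const_eq poly_pCons_0)
next
  fix y
  assume "\<exists>p. uniform_limit real_spectrum (\<lambda>n t. t * poly (p n) t) f sequentially \<and>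
      (\<lambda>n. poly_no_const (p n) a) \<longlonglongrightarrow> y"
  then obtain p where p: "uniform_limit real_spectrum (\<lambda>n t. t * poly (p n) t) f sequentially"
    "(\<lambda>n. poly_no_const (p n) a) \<longlonglongrightarrow> y" by blast
  then show "y = cfc f a"
    using rpoly_at_tendsto_cfc[OF f(1), of "\<lambda>n. pCons 0 (p n)"]
    by (intro LIMSEQ_unique[OF p(2)]) (simp add: poly_no_const_eq poly_pCons_0)
qed

end


section \<open>The approximation argument\<close>

text \<open>A spectral point t of \<open>1 - r\<close> other than 0 and 1 gives the spectral point 1
  - t of \<open>r\<close>; positivity yields t \<le> 1 and the norm bound t \<ge> 0. Positivity in
  \<open>B\<close> suffices because enlarging the algebra shrinks the spectrum.\<close>

lemma unit_interval_element_one_minus: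
  fixes r :: "'a::unital_cstar_algebra"
  assumes r: "r \<in> positive_in B" "norm r \<le> 1"
  shows "unit_interval_element (1 - r)"
proof
  show "(1 - r)\<^sup>\<star> = 1 - r" using r by (simp add: positive_in_def star_diff)
next
  fix t assume t: "complex_of_real t \<in> spectrum_in UNIV (1 - r)"
  show "t \<in> {0..1}"
  proof (cases "t = 0 \<or> t = 1")
    case False
    define z where "z = complex_of_real (1 - t)"
    have z: "z \<in> spectrum_in UNIV r"
    proof (rule ccontr)
      assume "z \<notin> spectrum_in UNIV r"
      then have "unit_elem ((-1) *\<^sub>C (z *\<^sub>C 1 - r))"
        by (intro unit_elem_scaleC unit_elem_if_not_in_spectrum) auto
      also have "(-1) *\<^sub>C (z *\<^sub>C 1 - r) = complex_of_real t *\<^sub>C 1 - (1 - r)"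
        by (simp add: z_def scaleC_minus_one scaleC_diff_left scaleC_one)
      finally show False using t False unit_elem_iff_spectrum[of "complex_of_real t" "1 - r"] by simp
    qed
    then have "cmod z \<le> 1" using spectrum_norm_le[OF z] r(2) by simp
    then have "\<bar>1 - t\<bar> \<le> 1" by (simp only: z_def norm_of_real)
    moreover have "z \<in> spectrum_in B r" using z spectrum_in_mono[of B UNIV r] by auto
    then have "0 \<le> 1 - t" using r(1) by (auto simp: positive_in_def z_def)
    ultimately show ?thesis by auto
  qed auto
qed

text \<open>Multiply the witnesses by \<open>c\<close>. This trades the cut-down of
  \<open>1 - r\<^sub>0\<close> for \<open>1 - r\<close>.\<close>

lemma cuntz_le_conjugate:
  fixes a x c :: "'a::cstar_algebra"
  assumes "x \<precsim> a"
  shows "c * x * c\<^sup>\<star> \<precsim> a"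
proof -
  obtain v where v: "(\<lambda>n. norm (v n * a * (v n)\<^sup>\<star> - x)) \<longlonglongrightarrow> 0"
    using assms by (auto simp: cuntz_le_def)
  have "(\<lambda>n. c * (v n * a * (v n)\<^sup>\<star> - x) * c\<^sup>\<star>) \<longlonglongrightarrow> c * 0 * c\<^sup>\<star>"
    by (intro tendsto_intros tendsto_norm_zero_cancel[OF v])
  moreover have "c * (v n * a * (v n)\<^sup>\<star> - x) * c\<^sup>\<star> = (c * v n) * a * (c * v n)\<^sup>\<star> - c * x * c\<^sup>\<star>" for n
    by (simp add: star_mult left_diff_distrib right_diff_distrib mult.assoc)
  ultimately have "(\<lambda>n. norm ((c * v n) * a * (c * v n)\<^sup>\<star> - c * x * c\<^sup>\<star>)) \<longlonglongrightarrow> 0"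
    by (simp add: tendsto_norm_zero)
  then show ?thesis unfolding cuntz_le_def by (intro exI[of _ "\<lambda>n. c * v n"])
qed

lemma norm_add_diff_le:
  fixes a b c :: "'a::real_normed_vector"
  assumes "x = a + (b - c)"
  shows "norm x \<le> norm a + (norm b + norm c)"
  unfolding assms by (rule order_trans[OF norm_triangle_ineq add_left_mono[OF norm_triangle_ineq4]])

text \<open>
  \<open>h\<close> acts as a unit on \<open>r\<close>, so \<open>(1 - h) x (1 - h)\<close> is annihilated by \<open>r\<close>; the remaining
  part \<open>h x + x h - h x h\<close> of \<open>x\<close> is close to \<open>B\<close>.
\<close>

lemma perturb_into_subalgebra:
  fixes x r\<^sub>0 r h l b\<^sub>1 b\<^sub>2 :: "'a::unital_cstar_algebra"
  assumes B: "cstar_subalgebra B" and mem: "r \<in> B" "h \<in> B" "b\<^sub>1 \<in> B" "b\<^sub>2 \<in> B" "l \<in> multipliers B"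
    and h: "h = l * r\<^sub>0" "h = r\<^sub>0 * l" "r * h = r" "h * r = r" "norm h \<le> 1"
    and l: "norm l \<le> K" "0 < K"
    and approx: "norm (r\<^sub>0 * x - b\<^sub>1) < \<delta>" "norm (x * r\<^sub>0 - b\<^sub>2) < \<delta>"
  shows "\<exists>y. norm (y - x) < 3 * (K * \<delta>) \<and> r * y \<in> B \<and> y * r \<in> B"
proof -
  \<comment> \<open>In h x + x h - h x h, replace \<open>r\<^sub>0 * x\<close> by
    \<open>b\<^sub>1\<close> and \<open>x * r\<^sub>0\<close> by \<open>b\<^sub>2\<close>. Each of
    the three terms changes by less than \<open>K * \<delta>\<close>.\<close>
  define b where "b = l * b\<^sub>1 + b\<^sub>2 * l - h * (b\<^sub>2 * l)"
  define y where "y = (1 - h) * x * (1 - h) + b"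
  have b: "b \<in> B"
    unfolding b_def using mem
    by (intro cstar_subalgebra_diff[OF B] cstar_subalgebraD[OF B] multipliersD)
  have "r * (1 - h) = 0" "(1 - h) * r = 0" using h by (simp_all add: right_diff_distrib left_diff_distrib)
  then have "r * ((1 - h) * x * (1 - h)) = 0" "((1 - h) * x * (1 - h)) * r = 0"
    by (metis mult.assoc mult_zero_left, metis mult.assoc mult_zero_right)
  then have "r * y = r * b" "y * r = b * r" by (simp_all add: y_def distrib_left distrib_right)
  then have ry: "r * y \<in> B" "y * r \<in> B" using b mem(1) by (simp_all add: cstar_subalgebraD[OF B])
  define u where "u = r\<^sub>0 * x - b\<^sub>1"
  define v where "v = (x * r\<^sub>0 - b\<^sub>2) * l"
  have "l * (r\<^sub>0 * x) = h * x" "x * r\<^sub>0 * l = x * h" by (simp add: h(1) mult.assoc, simp add: h(2) mult.assoc)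
  then have "x - y = l * u + v - h * v"
    by (simp add: y_def b_def u_def v_def left_diff_distrib right_diff_distrib mult.assoc)
  then have "norm (y - x) \<le> norm (l * u) + norm v + norm (h * v)"
    by (metis norm_minus_commute norm_triangle_ineq norm_triangle_ineq4 add_right_mono order_trans)
  moreover have "norm (l * u) \<le> K * norm u"
    using norm_mult_ineq[of l u] mult_right_mono[OF l(1), of "norm u"] by simp
  moreover have "K * norm u < K * \<delta>" using approx(1) l(2) by (simp add: u_def)
  moreover have "norm v \<le> norm (x * r\<^sub>0 - b\<^sub>2) * K"
    unfolding v_def by (rule order_trans[OF norm_mult_ineq mult_left_mono[OF l(1)]]) simp
  moreover have "norm (x * r\<^sub>0 - b\<^sub>2) * K < K * \<delta>" using approx(2) l(2) by (simp add: mult.commute)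
  moreover have "norm (h * v) \<le> norm v"
    using norm_mult_ineq[of h v] mult_right_mono[OF h(5), of "norm v"] by simp
  ultimately have "norm (y - x) < 3 * (K * \<delta>)" by linarith
  then show ?thesis using ry by blast
qed

text \<open>For \<eta> < 1/2 this is symmetric:
  \<open>ramp \<eta> (1 - s) = 1 - ramp \<eta> s\<close>. Hence \<open>1 - ramp \<eta>\<close> at
  \<open>1 - r\<^sub>0\<close> is the same as \<open>ramp \<eta>\<close> at
  \<open>r\<^sub>0\<close>.\<close>

definition ramp :: "real \<Rightarrow> real \<Rightarrow> real" where
  "ramp \<eta> s = max 0 (min 1 ((s - \<eta>) / (1 - 2 * \<eta>)))"

lemma ramp_bounds: "0 \<le> ramp \<eta> s" "ramp \<eta> s \<le> 1"
  by (auto simp: ramp_def)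

lemma continuous_on_ramp: "\<eta> < 1/2 \<Longrightarrow> continuous_on S (ramp \<eta>)"
  unfolding ramp_def by (intro continuous_intros) auto

lemma ramp_eq_0: "\<eta> < 1/2 \<Longrightarrow> s \<le> \<eta> \<Longrightarrow> ramp \<eta> s = 0"
  by (auto simp: ramp_def divide_simps)

lemma ramp_eq_1: "\<eta> < 1/2 \<Longrightarrow> 1 - \<eta> \<le> s \<Longrightarrow> ramp \<eta> s = 1"
  by (auto simp: ramp_def divide_simps)

lemma ramp_close:
  assumes "0 \<le> \<eta>" "\<eta> < 1/2" "s \<in> {0..1}"
  shows "\<bar>ramp \<eta> s - s\<bar> \<le> \<eta>"
proof -
  consider "s \<le> \<eta>" | "1 - \<eta> \<le> s" | "\<eta> < s" "s < 1 - \<eta>" by linarith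
  then show ?thesis
  proof cases
    case 3
    define u where "u = (s - \<eta>) / (1 - 2 * \<eta>)"
    have u: "u * (1 - 2 * \<eta>) = s - \<eta>" "0 < u" "u < 1" using assms 3 by (auto simp: u_def divide_simps)
    then have "ramp \<eta> s = u" by (simp add: ramp_def flip: u_def)
    moreover have "u - s = \<eta> * (2 * u - 1)" using u(1) by (simp add: algebra_simps)
    moreover have "\<eta> * \<bar>2 * u - 1\<bar> \<le> \<eta> * 1" using u assms by (intro mult_left_mono) auto
    ultimately show ?thesis using assms(1) by (simp add: abs_mult)
  qed (use assms in \<open>auto simp: ramp_eq_0 ramp_eq_1\<close>)
qed

theorem proposition2p5:
  fixes \<Omega> :: "'a::unital_cstar_algebra cstar_structure set"
    and \<epsilon> :: real and m :: nat and x :: "nat \<Rightarrow> 'a" and a :: 'a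
  assumes "\<forall>X\<in>\<Omega>. is_cstar_algebra X"
    and "in_GTA TYPE('a) \<Omega>"
    and "\<epsilon> > 0"
    and "m > 0"
    and "a \<in> positive_in UNIV"
    and "norm a = 1"
  shows "\<exists>(y :: nat \<Rightarrow> 'a) B r.
           cstar_subalgebra B \<and> induced_structure B \<in> \<Omega> \<and>
           r \<in> positive_in B \<and> norm r \<le> 1 \<and>
           (\<forall>j\<in>{1..m}. norm (y j - x j) < \<epsilon>) \<and>
           (\<forall>j\<in>{1..m}. r * y j \<in> B \<and> y j * r \<in> B) \<and>
           (\<forall>j\<in>{1..m}. norm (r * x j - x j * r) < \<epsilon>) \<and>
           1 - r \<precsim> a \<and>
           norm (r * a * r) \<ge> 1 - \<epsilon>"
proof -
  define M where "M = 1 + (\<Sum>j\<in>{1..m}. norm (x j))"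
  have M1: "1 \<le> M" by (simp add: M_def sum_nonneg)
  have M: "norm (x j) \<le> M" if "j \<in> {1..m}" for j
    using member_le_sum[OF that, of "\<lambda>j. norm (x j)"] by (simp add: M_def)
  \<comment> \<open>Passing from \<open>r\<^sub>0\<close> to \<open>r\<close> costs \<eta> in norm,
    hence \<open>2 * (\<eta> * M)\<close> in each commutator and \<open>2 * \<eta>\<close> in the
    last estimate, both at most half of \<epsilon>. The bound 1/4 keeps the ramp
    nondegenerate.\<close>
  define \<eta> where "\<eta> = min (1/4) (\<epsilon> / (4 * M))"
  have \<eta>: "0 < \<eta>" "\<eta> < 1/2" "\<eta> \<le> 1/4" using \<open>\<epsilon> > 0\<close> M1 by (auto simp: \<eta>_def)
  have \<eta>M: "\<eta> * M \<le> \<epsilon> / 4"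
  proof -
    have "\<eta> \<le> \<epsilon> / (4 * M)" by (simp add: \<eta>_def)
    then show ?thesis using M1 by (simp add: pos_le_divide_eq mult_ac)
  qed
  have \<eta>\<epsilon>: "\<eta> \<le> \<epsilon> / 4" using \<eta>M mult_left_mono[OF M1, of \<eta>] \<eta>(1) by linarith
  \<comment> \<open>The 1/2 puts \<delta> below \<eta>, so \<open>s - \<delta>\<close> is positive
    wherever the ramp is nonzero; the \<epsilon>/4 compensates for the norm bound
    \<open>1 / \<eta>\<close> of \<open>L\<close> when the \<open>x j\<close> are perturbed.\<close>
  define \<delta> where "\<delta> = \<eta> * min (1/2) (\<epsilon> / 4)"
  have \<delta>: "0 < \<delta>" using \<eta>(1) \<open>\<epsilon> > 0\<close> by (simp add: \<delta>_def)
  have "\<delta> \<le> \<eta> * (1/2)" "\<delta> \<le> \<eta> * (\<epsilon> / 4)"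
    unfolding \<delta>_def using \<eta>(1) by (intro mult_left_mono; simp)+
  moreover from mult_right_mono[OF \<eta>(3), of "\<epsilon> / 4"] \<open>\<epsilon> > 0\<close>
  have "\<eta> * (\<epsilon> / 4) \<le> 1/4 * (\<epsilon> / 4)" by linarith
  ultimately have \<delta>2: "\<delta> < \<eta>" "\<delta> \<le> \<epsilon> / 16" and "1 / \<eta> * \<delta> \<le> \<epsilon> / 4"
    using \<eta>(1) by (linarith, linarith, simp add: pos_divide_le_eq mult.commute)
  then have \<delta>3: "3 * (1 / \<eta> * \<delta>) < \<epsilon>" using \<open>\<epsilon> > 0\<close> by linarith

  have one: "(1::'a) \<in> positive_in UNIV"
    using square_positive_in[OF cstar_subalgebra_UNIV, of "1::'a"] by simp
  have fin: "finite (x ` {1..m})" by simp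
  from conjunct2[OF assms(2)[unfolded in_GTA_def], rule_format,
      OF \<delta> fin assms(5,6) one eq_refl[OF norm_one]]
  obtain B r\<^sub>0 where B: "cstar_subalgebra B" "induced_structure B \<in> \<Omega>"
    and r0: "r\<^sub>0 \<in> positive_in B" "norm r\<^sub>0 \<le> 1"
    and near: "\<forall>z\<in>x ` {1..m}. approx_in \<delta> (r\<^sub>0 * z) B \<and> approx_in \<delta> (z * r\<^sub>0) B"
    and com: "\<forall>z\<in>x ` {1..m}. norm (r\<^sub>0 * z - z * r\<^sub>0) < \<delta>"
    and cut: "cut_down (1 * 1 - 1 * r\<^sub>0 * 1) \<delta> \<precsim> a"
    and big: "norm (r\<^sub>0 * a * r\<^sub>0) \<ge> 1 - \<delta>"
    by (elim exE conjE)
  have r0B: "r\<^sub>0 \<in> B" using r0(1) by (simp add: positive_in_def)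
  \<comment> \<open>The calculus is run at \<open>d\<close> because the Cuntz hypothesis concerns
    its cut-down; a factor \<open>1 - s\<close> then stands for \<open>r\<^sub>0\<close>.\<close>
  define d where "d = 1 - r\<^sub>0"
  interpret unit_interval_element d
    unfolding d_def by (rule unit_interval_element_one_minus[OF r0])
  have dB: "d \<in> multipliers B"
    unfolding d_def by (intro multipliers_diff[OF B(1)] multipliers_one subalgebra_multipliers[OF B(1)] r0B)

  \<comment> \<open>\<open>l\<close> is the reciprocal of \<open>1 - s\<close> capped at
    \<open>1 / \<eta>\<close>, and \<open>(1 - s) * w s\<close> is the square root of
    \<open>1 - ramp \<eta> s\<close>.\<close>
  define l where "l = (\<lambda>s. 1 / max (1 - s) \<eta>)"
  define w where "w = (\<lambda>s. sqrt (1 - ramp \<eta> s) * l s)"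
  \<comment> \<open>Its square times \<open>max (s - \<delta>) 0\<close> is the ramp. The maximum
    keeps the denominator positive and alters it only for s < \<eta>, where the ramp is 0.\<close>
  define c where "c = (\<lambda>s. sqrt (ramp \<eta> s / max (s - \<delta>) (\<eta> - \<delta>)))"
  have ne: "max (1 - s) \<eta> \<noteq> 0" "max (s - \<delta>) (\<eta> - \<delta>) \<noteq> 0" for s
    using \<eta>(1) \<delta>2(1) by (auto simp: max_def)
  have contl: "continuous_on {0..1} l"
    unfolding l_def by (intro continuous_intros) (use ne in auto)
  have "continuous_on {0..1} w"
    unfolding w_def by (intro continuous_intros contl continuous_on_ramp \<eta>)
  moreover have "continuous_on {0..1} c"
    unfolding c_def by (intro continuous_intros continuous_on_ramp \<eta>) (use ne in auto)
  ultimately have cont: "continuous_on {0..1} l" "continuous_on {0..1} w" "continuous_on {0..1} c"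
    "continuous_on {0..1} (ramp \<eta>)" "continuous_on {0..1} (\<lambda>s. 1 - s :: real)"
    "continuous_on {0..1} (\<lambda>s. max (s - \<delta>) 0)" "continuous_on {0..1} (\<lambda>s. 1 - ramp \<eta> s)"
    using contl by (auto intro!: continuous_intros continuous_on_ramp \<eta>)
  have "1 - d = r\<^sub>0" by (simp add: d_def)
  then have cfc_1: "cfc (\<lambda>s. 1 - s) d = r\<^sub>0"
    using cfc_diff[of "\<lambda>_. 1" "\<lambda>s. s"] by (simp add: cfc_const_1 cfc_ident continuous_on_id)
  define L where "L = cfc l d"
  define h where "h = cfc (\<lambda>s. (1 - s) * l s) d"
  define W where "W = cfc (\<lambda>s. (1 - s) * w s) d"
  \<comment> \<open>Being the square of a self-adjoint element makes \<open>r\<close> positive in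
    \<open>B\<close>; \<open>W\<close> lies in \<open>B\<close> thanks to its factor
    \<open>r\<^sub>0\<close>.\<close>
  define r where "r = W * W"
  have conth: "continuous_on {0..1} (\<lambda>s. (1 - s) * l s)" "continuous_on {0..1} (\<lambda>s. (1 - s) * w s)"
    using cont by (auto intro!: continuous_on_mult)
  have h: "h = r\<^sub>0 * L"
    unfolding h_def L_def by (simp add: cfc_mult cont cfc_1)
  have h': "h = L * r\<^sub>0"
    unfolding h_def L_def using cfc_mult[OF cont(1,5)] by (simp add: cfc_1 mult.commute)
  have hs: "(1 - s) * l s = 1" if "s \<le> 1 - \<eta>" for s
    using that \<eta>(1) by (simp add: l_def max_def)
  have LB: "L \<in> multipliers B" unfolding L_def by (rule cfc_multipliers[OF B(1) dB cont(1)])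
  have hB: "h \<in> B" unfolding h using LB r0B by (rule multipliersD)
  have "W = r\<^sub>0 * cfc w d" unfolding W_def by (simp add: cfc_mult cont cfc_1)
  then have WB: "W \<in> B" using multipliersD(2)[OF cfc_multipliers[OF B(1) dB cont(2)] r0B] by simp
  have rB: "r \<in> B" unfolding r_def by (intro cstar_subalgebraD[OF B(1)] WB)
  have r_pos: "r \<in> positive_in B"
    unfolding r_def by (rule square_positive_in[OF B(1) WB]) (simp add: W_def star_cfc conth)
  have "r = cfc (\<lambda>s. ((1 - s) * w s) * ((1 - s) * w s)) d"
    unfolding r_def W_def by (simp add: cfc_mult conth)
  also have "\<dots> = cfc (\<lambda>s. 1 - ramp \<eta> s) d"
  proof (rule cfc_cong)
    fix s :: real
    have "(1 - s) * w s = sqrt (1 - ramp \<eta> s) * ((1 - s) * l s)" by (simp add: w_def)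
    also have "\<dots> = sqrt (1 - ramp \<eta> s)"
    proof (cases "s \<le> 1 - \<eta>")
      case False
      then have "ramp \<eta> s = 1" using \<eta>(2) by (intro ramp_eq_1) auto
      then show ?thesis by simp
    qed (simp add: hs)
    finally show "((1 - s) * w s) * ((1 - s) * w s) = 1 - ramp \<eta> s" using ramp_bounds[of \<eta> s] by simp
  qed
  finally have r: "r = cfc (\<lambda>s. 1 - ramp \<eta> s) d" .
  \<comment> \<open>Where \<open>(1 - s) * l s\<close> can differ from 1, the factor
    \<open>1 - ramp \<eta> s\<close> is 0.\<close>
  have hr: "(1 - ramp \<eta> s) * ((1 - s) * l s) = 1 - ramp \<eta> s" for s
  proof (cases "s \<le> 1 - \<eta>")
    case False
    then have "ramp \<eta> s = 1" using \<eta>(2) by (intro ramp_eq_1) auto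
    then show ?thesis by simp
  qed (simp add: hs)
  have rh: "r * h = r"
    unfolding r h_def by (simp add: hr flip: cfc_mult[OF cont(7) conth(1)])
  have hr': "h * r = r"
    unfolding r h_def
    by (simp only: cfc_mult[OF conth(1) cont(7), symmetric] mult.commute[of "(1 - _) * l _"] hr)
  have nL: "norm L \<le> 1 / \<eta>"
    unfolding L_def using \<eta>(1) by (intro norm_cfc_le cont) (auto simp: l_def frac_le)
  have nh: "norm h \<le> 1"
    unfolding h_def using \<eta>(1) by (intro norm_cfc_le conth) (auto simp: l_def divide_simps)
  have nr: "norm r \<le> 1"
    unfolding r using ramp_bounds by (intro norm_cfc_le cont) auto
  have "r - r\<^sub>0 = cfc (\<lambda>s. (1 - ramp \<eta> s) - (1 - s)) d"
    by (subst cfc_diff) (simp_all add: cont cfc_1 r)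
  also have "norm \<dots> \<le> \<eta>"
    using ramp_close[of \<eta>] \<eta>
    by (intro norm_cfc_le continuous_on_diff cont) (auto simp: abs_minus_commute)
  finally have rr0: "norm (r - r\<^sub>0) \<le> \<eta>" .

  \<comment> \<open>Moving the given elements so that products with \<open>r\<close> land in
    \<open>B\<close>\<close>
  have "\<exists>y. norm (y - x j) < \<epsilon> \<and> r * y \<in> B \<and> y * r \<in> B" if j: "j \<in> {1..m}" for j
  proof -
    obtain b\<^sub>1 b\<^sub>2 where "b\<^sub>1 \<in> B" "b\<^sub>2 \<in> B" "norm (r\<^sub>0 * x j - b\<^sub>1) < \<delta>" "norm (x j * r\<^sub>0 - b\<^sub>2) < \<delta>"
      using bspec[OF near imageI[OF j]] by (auto simp: approx_in_def)
    then have "\<exists>y. norm (y - x j) < 3 * (1 / \<eta> * \<delta>) \<and> r * y \<in> B \<and> y * r \<in> B"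
      using \<eta>(1) by (intro perturb_into_subalgebra[OF B(1) rB hB _ _ LB h' h rh hr' nh nL]) auto
    then show ?thesis using \<delta>3 by (meson order_less_trans)
  qed
  then obtain y where y: "\<And>j. j \<in> {1..m} \<Longrightarrow> norm (y j - x j) < \<epsilon> \<and> r * y j \<in> B \<and> y j * r \<in> B"
    by metis

  \<comment> \<open>Commutators with \<open>r\<close> and the norm of
    \<open>r * a * r\<close>\<close>
  have comr: "norm (r * x j - x j * r) < \<epsilon>" if j: "j \<in> {1..m}" for j
  proof -
    have "norm (r * x j - x j * r) \<le>
        norm (r\<^sub>0 * x j - x j * r\<^sub>0) + (norm ((r - r\<^sub>0) * x j) + norm (x j * (r - r\<^sub>0)))"
      by (rule norm_add_diff_le) (simp add: algebra_simps)
    moreover have "norm ((r - r\<^sub>0) * x j) \<le> \<eta> * M"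
      by (rule order_trans[OF norm_mult_ineq]) (use rr0 M[OF j] \<eta>(1) in \<open>auto intro: mult_mono\<close>)
    moreover have "norm (x j * (r - r\<^sub>0)) \<le> M * \<eta>"
      by (rule order_trans[OF norm_mult_ineq]) (use rr0 M[OF j] M1 in \<open>auto intro: mult_mono\<close>)
    ultimately show ?thesis using bspec[OF com imageI[OF j]] \<eta>M \<delta>2(2) \<open>\<epsilon> > 0\<close> by (simp add: mult.commute)
  qed

  have "norm (r\<^sub>0 * a * r\<^sub>0) \<le> norm (r * a * r) + 2 * \<eta>"
  proof -
    have "norm (r\<^sub>0 * a * r\<^sub>0) \<le>
        norm (r * a * r) + (norm ((r\<^sub>0 - r) * a * r\<^sub>0) + norm (r * a * (r - r\<^sub>0)))"
      by (rule norm_add_diff_le) (simp add: algebra_simps)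
    moreover have "norm (u * a * v) \<le> norm u * norm v" for u v
      using norm_mult_ineq[of "u * a" v] mult_right_mono[OF norm_mult_ineq[of u a], of "norm v"] assms(6) by simp
    from this[of "r\<^sub>0 - r" r\<^sub>0] this[of r "r - r\<^sub>0"]
    have "norm ((r\<^sub>0 - r) * a * r\<^sub>0) \<le> \<eta>" "norm (r * a * (r - r\<^sub>0)) \<le> \<eta>"
      using mult_mono[OF rr0 r0(2)] mult_mono[OF nr rr0] \<eta>(1) by (auto simp: norm_minus_commute[of r\<^sub>0])
    ultimately show ?thesis by linarith
  qed
  then have bigr: "1 - \<epsilon> \<le> norm (r * a * r)"
    using big \<delta>2(2) \<eta>\<epsilon> \<open>\<epsilon> > 0\<close> by linarith

  \<comment> \<open>Cuntz subequivalence of \<open>1 - r\<close>\<close>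
  have "cut_down d \<delta> = cfc (\<lambda>s. max (s - \<delta>) 0) d"
    unfolding cut_down_def by (rule cont_fun_calc_eq_cfc[OF cont(6)]) (use \<delta> in simp)
  then have "cfc (\<lambda>s. max (s - \<delta>) 0) d \<precsim> a" using cut by (simp add: d_def)
  from cuntz_le_conjugate[OF this, of "cfc c d"]
  have "cfc (\<lambda>s. c s * max (s - \<delta>) 0 * c s) d \<precsim> a"
    by (simp add: cfc_mult cont continuous_on_mult star_cfc)
  also have "cfc (\<lambda>s. c s * max (s - \<delta>) 0 * c s) d = cfc (ramp \<eta>) d"
  proof (rule cfc_cong)
    fix s :: real
    show "c s * max (s - \<delta>) 0 * c s = ramp \<eta> s"
    proof (cases "s \<le> \<eta>")
      case True
      then show ?thesis using \<eta>(2) by (simp add: c_def ramp_eq_0)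
    next
      case False
      then have "max (s - \<delta>) (\<eta> - \<delta>) = s - \<delta>" "max (s - \<delta>) 0 = s - \<delta>" "s - \<delta> > 0" using \<delta>2(1) by auto
      moreover from this have "c s * c s = ramp \<eta> s / (s - \<delta>)" using ramp_bounds[of \<eta> s] by (simp add: c_def)
      moreover have "c s * max (s - \<delta>) 0 * c s = c s * c s * max (s - \<delta>) 0" by (simp add: mult_ac)
      ultimately show ?thesis by simp
    qed
  qed
  also have "cfc (ramp \<eta>) d = 1 - r"
    unfolding r using cfc_diff[of "\<lambda>_. 1" "ramp \<eta>"] by (simp add: cfc_const_1 cont)
  finally have "1 - r \<precsim> a" .
  then show ?thesis using B r_pos nr y comr bigr by blast
qed

end
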